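(* Let $G$ be a $P_7$-free graph and let $\Omega$ be a potential maximal clique in $G$. Then there exists a set $\Omega' \subseteq V(G)$ with $|\Omega'| \leq 68$ such that $\Omega \subseteq N_G[\Omega']$.
   Context: All graphs are finite and simple. $P_t$ denotes the path on $t$ vertices; a graph is $P_t$-free if it has no induced subgraph isomorphic to $P_t$. For $X\subseteq V(G)$, $N_G(X)$ is the set of vertices outside $X$ adjacent to some vertex of $X$, and $N_G[X] = X \cup N_G(X)$. A set $F$ of non-edges of $G$ is a chordal completion if the graph $G+F = (V(G), E(G)\cup F)$ is chordal (has no induced cycle on at least four vertices). A set $\Omega \subseteq V(G)$ is a potential maximal clique if there is an inclusion-wise minimal chordal completion $F$ of $G$ such that $\Omega$ is a maximal clique of $G+F$. Equivalently, $\Omega$ is a potential maximal clique iff (1) no connected component $D$ of $G-\Omega$ satisfies $N_G(D)=\Omega$, and (2) for every pair of non-adjacent vertices $u,v\in\Omega$ there is a connected component $D$ of $G-\Omega$ with $\{u,v\}\subseteq N_G(D)$. *)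

theory Defs
  imports "HOL-Library.Ramsey"
begin

text \<open>
  A graph is a pair of a vertex set \<open>V\<close> and a set \<open>E\<close> of two-element subsets of \<open>V\<close>, so that
  \<open>{u, v} \<in> E\<close> entails \<open>u \<noteq> v\<close>. Cliques are those of \<^theory>\<open>HOL-Library.Ramsey\<close>.
\<close>

definition finite_simple_graph :: "'a set \<Rightarrow> 'a set set \<Rightarrow> bool" where
  "finite_simple_graph V E \<longleftrightarrow> finite V \<and> E \<subseteq> nsets V 2"

definition induced_edges :: "'a set set \<Rightarrow> 'a set \<Rightarrow> 'a set set" where
  "induced_edges E X = {e \<in> E. e \<subseteq> X}"

definition graph_iso :: "'a set \<Rightarrow> 'a set set \<Rightarrow> 'b set \<Rightarrow> 'b set set \<Rightarrow> bool" where
  "graph_iso V E W D \<longleftrightarrow>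
     (\<exists>f. bij_betw f V W \<and> (\<forall>u\<in>V. \<forall>v\<in>V. {u, v} \<in> E \<longleftrightarrow> {f u, f v} \<in> D))"

definition induced_free :: "'b set \<Rightarrow> 'b set set \<Rightarrow> 'a set \<Rightarrow> 'a set set \<Rightarrow> bool" where
  "induced_free W D V E \<longleftrightarrow> \<not> (\<exists>X\<subseteq>V. graph_iso W D X (induced_edges E X))"

text \<open>The path on \<open>t\<close> vertices and the cycle on \<open>k\<close> vertices (the latter a simple graph that is a
  cycle only for \<open>k \<ge> 3\<close>) have vertex set \<open>{..<t}\<close> and \<open>{..<k}\<close>, respectively.\<close>

definition path_edges :: "nat \<Rightarrow> nat set set" where
  "path_edges t = {{i, Suc i} | i. Suc i < t}"

definition cycle_edges :: "nat \<Rightarrow> nat set set" where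
  "cycle_edges k = {{i, Suc i mod k} | i. i < k}"

definition P_free :: "nat \<Rightarrow> 'a set \<Rightarrow> 'a set set \<Rightarrow> bool" where
  "P_free t V E \<longleftrightarrow> induced_free {..<t} (path_edges t) V E"

definition chordal :: "'a set \<Rightarrow> 'a set set \<Rightarrow> bool" where
  "chordal V E \<longleftrightarrow> (\<forall>k\<ge>4. induced_free {..<k} (cycle_edges k) V E)"

definition open_nbhd :: "'a set \<Rightarrow> 'a set set \<Rightarrow> 'a set \<Rightarrow> 'a set" where
  "open_nbhd V E X = {v \<in> V - X. \<exists>x\<in>X. {x, v} \<in> E}"

definition closed_nbhd :: "'a set \<Rightarrow> 'a set set \<Rightarrow> 'a set \<Rightarrow> 'a set" where
  "closed_nbhd V E X = X \<union> open_nbhd V E X"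

definition chordal_completion :: "'a set \<Rightarrow> 'a set set \<Rightarrow> 'a set set \<Rightarrow> bool" where
  "chordal_completion V E F \<longleftrightarrow> F \<subseteq> nsets V 2 - E \<and> chordal V (E \<union> F)"

definition minimal_chordal_completion :: "'a set \<Rightarrow> 'a set set \<Rightarrow> 'a set set \<Rightarrow> bool" where
  "minimal_chordal_completion V E F \<longleftrightarrow>
     chordal_completion V E F \<and> \<not> (\<exists>F'\<subset>F. chordal_completion V E F')"

definition maximal_clique :: "'a set \<Rightarrow> 'a set set \<Rightarrow> 'a set \<Rightarrow> bool" where
  "maximal_clique V E K \<longleftrightarrow>
     K \<subseteq> V \<and> clique K E \<and> \<not> (\<exists>K'\<subseteq>V. K \<subset> K' \<and> clique K' E)"

definition potential_maximal_clique :: "'a set \<Rightarrow> 'a set set \<Rightarrow> 'a set \<Rightarrow> bool" where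
  "potential_maximal_clique V E \<Omega> \<longleftrightarrow>
     (\<exists>F. minimal_chordal_completion V E F \<and> maximal_clique V (E \<union> F) \<Omega>)"

lemma path_simple: "finite_simple_graph {..<t} (path_edges t)"
  by (auto simp: finite_simple_graph_def path_edges_def nsets_def)

lemma cycle_simple: "k \<ge> 2 \<Longrightarrow> finite_simple_graph {..<k} (cycle_edges k)"
  by (auto simp: finite_simple_graph_def cycle_edges_def nsets_def card_insert_if mod_Suc)

end

(*
  Let A and B be disjoint connected sets with no edges between them, and let every vertex of S
  have neighbours in both. Some p, q in A are such that every u in S not adjacent to p or q either
  starts an induced path u, a, a', a'' into A or has all its neighbours in A adjacent to q; likewise
  for B. A vertex of the first kind on both sides would be the centre of an induced P_7. On the
  vertices of the second kind, private neighbours on one side are adjacent, so extremal choices of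
  neighbourhoods produce induced P_7s unless 22 closed neighbourhoods cover S.

  For a component D of G - Omega this covers N(D), the second connected set being a component of
  G - N[D]. Write F(w) for the set of components with w in their neighbourhood. Choose u with F(u)
  inclusion-minimal and then w, not adjacent to u and with F(u) not contained in F(w), such that
  the intersection of F(u) and F(w) is minimal. With D in F(u) - F(w), D' in F(w) - F(u) and D''
  in both, a vertex of Omega outside N[u], N[w], N(D), N(D') and N(D'') would give an induced path
  on at least seven vertices running alternately through Omega and four components. This yields
  2 + 3 * 22 = 68.
*)
theory Submission
  imports Defs
begin

section \<open>Induced paths\<close>

definition adj :: "'a set set \<Rightarrow> 'a \<Rightarrow> 'a \<Rightarrow> bool" where
  "adj E u v \<longleftrightarrow> {u, v} \<in> E"

lemma adj_commute: "adj E u v \<longleftrightarrow> adj E v u"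
  by (simp add: adj_def insert_commute)

text \<open>Induced paths are lists, so that they can be cut and glued. For the last vertex the
  quantifier is empty, so \<open>hd []\<close> never matters.\<close>

primrec ipath :: "'a set set \<Rightarrow> 'a list \<Rightarrow> bool" where
  "ipath E [] \<longleftrightarrow> True"
| "ipath E (x # xs) \<longleftrightarrow> x \<notin> set xs \<and> (\<forall>y\<in>set xs. adj E x y \<longleftrightarrow> y = hd xs) \<and> ipath E xs"

lemma edge_in_V:
  assumes "finite_simple_graph V E" "adj E u v"
  shows "u \<in> V" "v \<in> V" "u \<noteq> v"
  using assms by (auto simp: adj_def finite_simple_graph_def nsets_def card_insert_if split: if_splits)

lemma ipath_distinct: "ipath E xs \<Longrightarrow> distinct xs"
  by (induction xs) auto

lemma ipath_nth_less:
  "ipath E xs \<Longrightarrow> i < j \<Longrightarrow> j < length xs \<Longrightarrow> adj E (xs ! i) (xs ! j) \<longleftrightarrow> j = Suc i"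
proof (induction xs arbitrary: i j)
  case (Cons x xs)
  show ?case
  proof (cases i)
    case 0
    obtain j' where j: "j = Suc j'" using Cons.prems by (cases j) auto
    have "j' < length xs" "distinct xs" "xs \<noteq> []" using Cons.prems j ipath_distinct by auto
    then have "xs ! j' = hd xs \<longleftrightarrow> j' = 0"
      by (simp add: hd_conv_nth nth_eq_iff_index_eq)
    then show ?thesis using Cons.prems 0 j by auto
  next
    case (Suc i')
    obtain j' where "j = Suc j'" using Cons.prems by (cases j) auto
    then show ?thesis using Cons Suc by auto
  qed
qed simp

lemma ipath_nth:
  assumes "ipath E xs" "i < length xs" "j < length xs" "i \<noteq> j"
  shows "adj E (xs ! i) (xs ! j) \<longleftrightarrow> j = Suc i \<or> i = Suc j"
  using ipath_nth_less[of E xs i j] ipath_nth_less[of E xs j i] assms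
  by (cases "i < j") (auto simp: adj_commute)

lemma ipath_append:
  assumes "xs \<noteq> []" "ys \<noteq> []"
  shows "ipath E (xs @ ys) \<longleftrightarrow> ipath E xs \<and> ipath E ys \<and> set xs \<inter> set ys = {} \<and>
    (\<forall>x\<in>set xs. \<forall>y\<in>set ys. adj E x y \<longleftrightarrow> x = last xs \<and> y = hd ys)"
  using assms(1)
proof (induction xs)
  case (Cons a xs)
  show ?case
  proof (cases "xs = []")
    case True
    then show ?thesis using assms by auto
  next
    case False
    have hl: "hd xs \<in> set xs" "last xs \<in> set xs" "hd (xs @ ys) = hd xs" "last (a # xs) = last xs"
      using False by auto
    show ?thesis
    \<comment> \<open>Under disjointness \<open>a\<close> is not \<open>last xs\<close> and
      \<open>hd xs\<close> is not in \<open>ys\<close>, so the conditions on \<open>a\<close> split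
      into one for \<open>xs\<close> and one for \<open>ys\<close>. Otherwise both sides are
      false.\<close>
    proof (cases "a \<notin> set xs \<and> set xs \<inter> set ys = {}")
      case True
      then have ne: "a \<noteq> last xs" "\<forall>y\<in>set ys. y \<noteq> hd xs" using hl by auto
      have "(\<forall>y\<in>set (xs @ ys). adj E a y \<longleftrightarrow> y = hd (xs @ ys)) \<longleftrightarrow>
          (\<forall>y\<in>set xs. adj E a y \<longleftrightarrow> y = hd xs) \<and> (\<forall>y\<in>set ys. \<not> adj E a y)"
        using ne(2) by (simp add: hl(3) ball_Un)
      moreover have "(\<forall>x\<in>set (a # xs). \<forall>y\<in>set ys. adj E x y \<longleftrightarrow> x = last (a # xs) \<and> y = hd ys) \<longleftrightarrow>
          (\<forall>y\<in>set ys. \<not> adj E a y) \<and>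
          (\<forall>x\<in>set xs. \<forall>y\<in>set ys. adj E x y \<longleftrightarrow> x = last xs \<and> y = hd ys)"
        unfolding hl(4) using ne(1) by simp
      moreover have "a \<notin> set (xs @ ys) \<longleftrightarrow> a \<notin> set ys" "set (a # xs) \<inter> set ys = {} \<longleftrightarrow> a \<notin> set ys"
        using True by auto
      ultimately show ?thesis
        unfolding append_Cons ipath.simps Cons.IH[OF False] using True by argo
    next
      case False
      moreover have "a \<in> set xs \<Longrightarrow> a \<in> set (xs @ ys)"
        "set xs \<inter> set ys \<noteq> {} \<Longrightarrow> set (a # xs) \<inter> set ys \<noteq> {}"
        by auto
      ultimately show ?thesis
        unfolding append_Cons ipath.simps Cons.IH[OF \<open>xs \<noteq> []\<close>] by argo
    qed
  qed
qed simp

lemma ipath_take: "ipath E xs \<Longrightarrow> ipath E (take n xs)"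
proof (cases "take n xs = [] \<or> drop n xs = []")
  case True
  assume "ipath E xs"
  then show ?thesis using True by auto
next
  case False
  assume "ipath E xs"
  then have "ipath E (take n xs @ drop n xs)" by simp
  then show ?thesis using ipath_append False by blast
qed

lemma P_free_ipath:
  assumes "finite_simple_graph V E" "P_free t V E" "ipath E xs" "set xs \<subseteq> V"
  shows "length xs < t"
proof (rule ccontr)
  assume "\<not> length xs < t"
  define ys where "ys = take t xs"
  have ys: "ipath E ys" "length ys = t" "set ys \<subseteq> V" "distinct ys"
    using assms \<open>\<not> length xs < t\<close> ipath_take ipath_distinct set_take_subset[of t xs]
    by (fastforce simp: ys_def)+
  have "bij_betw (\<lambda>i. ys ! i) {..<t} (set ys)"
    using bij_betw_nth ys by blast
  moreover have "{i, j} \<in> path_edges t \<longleftrightarrow> {ys ! i, ys ! j} \<in> induced_edges E (set ys)"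
    if "i < t" "j < t" for i j
  proof (cases "i = j")
    case True
    have "\<not> adj E (ys ! i) (ys ! j)" using edge_in_V(3)[OF assms(1)] True by blast
    moreover have "{i, j} \<notin> path_edges t" using True by (auto simp: path_edges_def doubleton_eq_iff)
    ultimately show ?thesis by (simp add: induced_edges_def adj_def)
  next
    case False
    have "{i, j} \<in> path_edges t \<longleftrightarrow> j = Suc i \<or> i = Suc j"
      using that by (auto simp: path_edges_def doubleton_eq_iff)
    then show ?thesis using ipath_nth[OF ys(1)] that ys False by (auto simp: induced_edges_def adj_def)
  qed
  ultimately have "graph_iso {..<t} (path_edges t) (set ys) (induced_edges E (set ys))"
    by (auto simp: graph_iso_def)
  then show False using assms(2) ys by (auto simp: P_free_def induced_free_def)
qed

text \<open>Distinctness of the seven vertices comes from the adjacencies: adjacent ones differ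
  because there are no loops, and for any other two some vertex is adjacent to exactly one of
  them.\<close>

lemma no_P7:
  assumes G: "finite_simple_graph V E" and P7: "P_free 7 V E"
    and adj: "adj E a b" "adj E b c" "adj E c d" "adj E d e" "adj E e f" "adj E f g"
    and nonadj: "\<not> adj E a c" "\<not> adj E a d" "\<not> adj E a e" "\<not> adj E a f" "\<not> adj E a g"
      "\<not> adj E b d" "\<not> adj E b e" "\<not> adj E b f" "\<not> adj E b g"
      "\<not> adj E c e" "\<not> adj E c f" "\<not> adj E c g" "\<not> adj E d f" "\<not> adj E d g" "\<not> adj E e g"
  shows False
proof -
  have ne: "u \<noteq> v" if "adj E u v" for u v using edge_in_V(3)[OF G that] .
  have "a \<noteq> b" "b \<noteq> c" "c \<noteq> d" "d \<noteq> e" "e \<noteq> f" "f \<noteq> g" using adj ne by blast+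
  moreover have "a \<noteq> c" "a \<noteq> d" "a \<noteq> e" "a \<noteq> f" "b \<noteq> d" "b \<noteq> e" "b \<noteq> f" "b \<noteq> g"
    "c \<noteq> e" "c \<noteq> f" "c \<noteq> g" "d \<noteq> f" "d \<noteq> g" "e \<noteq> g"
    using adj nonadj by blast+
  moreover have "a \<noteq> g" using adj(1) nonadj(9) by (auto simp: adj_commute)
  ultimately have "ipath E [a, b, c, d, e, f, g]"
    using adj nonadj by simp
  moreover have "set [a, b, c, d, e, f, g] \<subseteq> V" using adj edge_in_V[OF G] by auto
  ultimately show False using P_free_ipath[OF G P7] by fastforce
qed

section \<open>Auxiliary facts on finite families of sets\<close>

lemma ex_minimal_set:
  assumes "finite T" "T \<noteq> {}"
  shows "\<exists>u\<in>T. \<forall>w\<in>T. f w \<subseteq> f u \<longrightarrow> f u \<subseteq> f w"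
proof -
  have "f ` T \<noteq> {}" "finite (f ` T)" using assms by auto
  from finite_has_minimal[OF this(2,1)] 
  show ?thesis by auto
qed

lemma no_strict_increase:
  assumes "finite S" and step: "\<And>z. z \<in> S \<Longrightarrow> f z \<in> S \<and> k z \<subset> k (f z)"
  shows "S = {}"
proof (rule ccontr)
  assume "S \<noteq> {}"
  then have "k ` S \<noteq> {}" "finite (k ` S)" using assms(1) by auto
  from finite_has_maximal[OF this(2,1)]
  obtain z where z: "z \<in> S" "\<forall>b\<in>k ` S. k z \<subseteq> b \<longrightarrow> k z = b" by auto
  then have "k z \<noteq> k (f z)" "k (f z) \<in> k ` S" "k z \<subseteq> k (f z)"
    using step[OF z(1)] by auto
  then show False using z(2) by auto
qed

text \<open>If no \<open>x\<close> dominates all of \<open>T\<close>, induction gives each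
  \<open>z\<close> an \<open>h z\<close> that dominates \<open>T - {z}\<close> but not
  \<open>z\<close>. Comparability makes \<open>h\<close> increase \<open>f\<close> or
  \<open>g\<close> strictly, and the direction persists under iteration, which is impossible in a
  finite set.\<close>

lemma biranking:
  assumes "finite T" "T \<noteq> {}"
    and "\<forall>x\<in>T. \<forall>y\<in>T. f x \<subseteq> f y \<or> f y \<subseteq> f x \<or> g x \<subseteq> g y \<or> g y \<subseteq> g x"
  shows "\<exists>x\<in>T. \<forall>y\<in>T. f x \<subseteq> f y \<or> g x \<subseteq> g y"
  using assms
proof (induction "card T" arbitrary: T rule: less_induct)
  case less
  show ?case
  proof (rule ccontr)
    assume neg: "\<not> ?case"
    have "\<exists>x\<in>T. (\<forall>y\<in>T - {z}. f x \<subseteq> f y \<or> g x \<subseteq> g y) \<and> \<not> f x \<subseteq> f z \<and> \<not> g x \<subseteq> g z"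
      if z: "z \<in> T" for z
    proof (cases "T = {z}")
      case True
      then show ?thesis using neg by auto
    next
      case False
      have "card (T - {z}) < card T" using z less.prems(1) by (metis card_Diff1_less)
      then have "\<exists>x\<in>T - {z}. \<forall>y\<in>T - {z}. f x \<subseteq> f y \<or> g x \<subseteq> g y"
        using less.hyps[of "T - {z}"] less.prems False z by auto
      then show ?thesis using neg by blast
    qed
    then obtain h where h: "h z \<in> T" "\<not> f (h z) \<subseteq> f z" "\<not> g (h z) \<subseteq> g z"
      and dom: "\<forall>y\<in>T - {z}. f (h z) \<subseteq> f y \<or> g (h z) \<subseteq> g y" if "z \<in> T" for z
      by metis
    have up: "f z \<subseteq> f (h z) \<or> g z \<subseteq> g (h z)" if "z \<in> T" for z
      using h[OF that] less.prems(3) that by blast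
    \<comment> \<open>If the growth switched from \<open>f\<close> to \<open>g\<close> at
      \<open>h z\<close>, then, as \<open>h (h z)\<close> dominates \<open>z\<close>, either
      \<open>f (h (h z))\<close> would lie inside \<open>f (h z)\<close> or \<open>g (h z)\<close>
      inside \<open>g z\<close>; the choice of \<open>h\<close> excludes both.\<close>
    have f_up: "f (h z) \<subseteq> f (h (h z))" if "z \<in> T" "f z \<subseteq> f (h z)" for z
    proof (rule ccontr)
      note hs = h[OF \<open>z \<in> T\<close>] h[OF h(1)[OF \<open>z \<in> T\<close>]]
      assume "\<not> f (h z) \<subseteq> f (h (h z))"
      then have g: "g (h z) \<subseteq> g (h (h z))" using up[OF hs(1)] by blast
      have "z \<in> T - {h z}" using that hs(2) by auto
      then have "f (h (h z)) \<subseteq> f z \<or> g (h (h z)) \<subseteq> g z" using dom[OF hs(1)] by blast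
      then show False using g that(2) hs by (meson order_trans)
    qed
    have g_up: "g (h z) \<subseteq> g (h (h z))" if "z \<in> T" "g z \<subseteq> g (h z)" for z
    proof (rule ccontr)
      note hs = h[OF \<open>z \<in> T\<close>] h[OF h(1)[OF \<open>z \<in> T\<close>]]
      assume "\<not> g (h z) \<subseteq> g (h (h z))"
      then have f: "f (h z) \<subseteq> f (h (h z))" using up[OF hs(1)] by blast
      have "z \<in> T - {h z}" using that hs(2) by auto
      then have "f (h (h z)) \<subseteq> f z \<or> g (h (h z)) \<subseteq> g z" using dom[OF hs(1)] by blast
      then show False using f that(2) hs by (meson order_trans)
    qed
    have "{z \<in> T. f z \<subseteq> f (h z)} = {}"
    proof (rule no_strict_increase[where f = h and k = f])
      fix z assume z: "z \<in> {z \<in> T. f z \<subseteq> f (h z)}"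
      then show "h z \<in> {z \<in> T. f z \<subseteq> f (h z)} \<and> f z \<subset> f (h z)"
        using h[of z] f_up[of z] by auto
    qed (use less.prems(1) in simp)
    moreover have "{z \<in> T. g z \<subseteq> g (h z)} = {}"
    proof (rule no_strict_increase[where f = h and k = g])
      fix z assume z: "z \<in> {z \<in> T. g z \<subseteq> g (h z)}"
      then show "h z \<in> {z \<in> T. g z \<subseteq> g (h z)} \<and> g z \<subset> g (h z)"
        using h[of z] g_up[of z] by auto
    qed (use less.prems(1) in simp)
    ultimately show False using up less.prems(2) by blast
  qed
qed

section \<open>Neighbourhoods in a connected set\<close>

text \<open>Connectedness as the absence of an empty cut. It is applied to the set of vertices with
  some property and yields an edge on which that property changes.\<close>

definition connected_in :: "'a set set \<Rightarrow> 'a set \<Rightarrow> bool" where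
  "connected_in E A \<longleftrightarrow> A \<noteq> {} \<and>
     (\<forall>M\<subseteq>A. M \<noteq> {} \<longrightarrow> M \<noteq> A \<longrightarrow> (\<exists>p\<in>M. \<exists>q\<in>A - M. adj E p q))"

definition component :: "'a set set \<Rightarrow> 'a set \<Rightarrow> 'a \<Rightarrow> 'a set" where
  "component E U x = {(a, b). a \<in> U \<and> b \<in> U \<and> adj E a b}\<^sup>* `` {x}"

lemma component_self: "x \<in> component E U x"
  by (simp add: component_def)

lemma component_subset: "x \<in> U \<Longrightarrow> component E U x \<subseteq> U"
proof
  fix y assume "x \<in> U" "y \<in> component E U x"
  then have "(x, y) \<in> {(a, b). a \<in> U \<and> b \<in> U \<and> adj E a b}\<^sup>*" by (simp add: component_def)
  then show "y \<in> U" using \<open>x \<in> U\<close> by (induction rule: rtrancl_induct) auto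
qed

lemma component_closed:
  assumes "y \<in> component E U x" "x \<in> U" "z \<in> U" "adj E y z"
  shows "z \<in> component E U x"
proof -
  have "(y, z) \<in> {(a, b). a \<in> U \<and> b \<in> U \<and> adj E a b}"
    using assms component_subset[of x U E] by auto
  then show ?thesis using assms(1) unfolding component_def Image_singleton_iff
    by (rule rtrancl.rtrancl_into_rtrancl[rotated])
qed

lemma component_induct:
  assumes y: "y \<in> component E U x" and "P x"
    and "\<And>y z. y \<in> component E U x \<Longrightarrow> z \<in> component E U x \<Longrightarrow> adj E y z \<Longrightarrow> P y \<Longrightarrow> P z"
  shows "P y"
proof -
  have "(x, y) \<in> {(a, b). a \<in> U \<and> b \<in> U \<and> adj E a b}\<^sup>*" using y by (simp add: component_def)
  then show ?thesis
  proof (induction rule: rtrancl_induct)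
    case (step y z)
    then have "y \<in> component E U x" "z \<in> component E U x"
      unfolding component_def Image_singleton_iff by (simp, meson rtrancl.rtrancl_into_rtrancl)
    then show ?case using assms(3) step by blast
  qed (rule assms(2))
qed

lemma component_connected:
  assumes "x \<in> U"
  shows "connected_in E (component E U x)"
proof -
  let ?C = "component E U x"
  have "\<exists>p\<in>M. \<exists>q\<in>?C - M. adj E p q" if M: "M \<subseteq> ?C" "M \<noteq> {}" "M \<noteq> ?C" for M
  proof (rule ccontr)
    assume "\<not> (\<exists>p\<in>M. \<exists>q\<in>?C - M. adj E p q)"
    then have no: "\<not> adj E p q" "\<not> adj E q p" if "p \<in> M" "q \<in> ?C - M" for p q
      using that adj_commute[of E p q] by blast+
    have "y \<in> M \<longleftrightarrow> x \<in> M" if "y \<in> ?C" for y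
      using that
    proof (rule component_induct)
      fix y z assume "y \<in> ?C" "z \<in> ?C" "adj E y z" "y \<in> M \<longleftrightarrow> x \<in> M"
      then show "z \<in> M \<longleftrightarrow> x \<in> M" using no(1)[of y z] no(2)[of z y] by blast
    qed simp
    then show False using M by blast
  qed
  then show ?thesis using component_self[of x E U] by (auto simp: connected_in_def)
qed

lemma connected_subset_component:
  assumes "connected_in E C" "C \<subseteq> U" "x \<in> U" "C \<inter> component E U x \<noteq> {}"
  shows "C \<subseteq> component E U x"
proof (rule ccontr)
  assume "\<not> C \<subseteq> component E U x"
  then have "C \<inter> component E U x \<noteq> C" by blast
  then obtain p q where "p \<in> C \<inter> component E U x" "q \<in> C - C \<inter> component E U x" "adj E p q"
    using assms(1,4) unfolding connected_in_def by (meson inf_le1)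
  then show False using component_closed[of p E U x q] assms(2,3) by blast
qed

section \<open>Modules and vertices that start no induced \<open>P_4\<close>\<close>

definition nbs :: "'a set set \<Rightarrow> 'a set \<Rightarrow> 'a \<Rightarrow> 'a set" where
  "nbs E A u = {x \<in> A. adj E u x}"

definition P4_into :: "'a set set \<Rightarrow> 'a set \<Rightarrow> 'a \<Rightarrow> bool" where
  "P4_into E A u \<longleftrightarrow> (\<exists>a\<in>A. \<exists>b\<in>A. \<exists>c\<in>A. adj E u a \<and> adj E a b \<and> adj E b c \<and>
     \<not> adj E u b \<and> \<not> adj E u c \<and> \<not> adj E a c)"

text \<open>A module in the sense of modular decomposition, relative to the graph induced by
  \<open>A\<close>: as \<open>x\<close> and \<open>y\<close> can be exchanged, each outside vertex
  of \<open>A\<close> sees all of \<open>M\<close> or none of it.\<close>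

definition module_in :: "'a set set \<Rightarrow> 'a set \<Rightarrow> 'a set \<Rightarrow> bool" where
  "module_in E A M \<longleftrightarrow> M \<subseteq> A \<and> (\<forall>z\<in>A - M. \<forall>x\<in>M. \<forall>y\<in>M. adj E z x \<longrightarrow> adj E z y)"

lemma module_inD:
  "module_in E A M \<Longrightarrow> z \<in> A - M \<Longrightarrow> x \<in> M \<Longrightarrow> y \<in> M \<Longrightarrow> adj E z x \<Longrightarrow> adj E z y"
  unfolding module_in_def by metis

lemma module_in_subset: "module_in E A M \<Longrightarrow> M \<subseteq> A"
  by (simp add: module_in_def)

lemma module_in_Un:
  assumes "module_in E A M" "module_in E A N" "p \<in> M" "p \<in> N"
  shows "module_in E A (M \<union> N)"
proof -
  have iff: "adj E z x \<longleftrightarrow> adj E z p" if "z \<in> A - (M \<union> N)" "x \<in> M \<union> N" for z x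
    using that module_inD[OF assms(1), of z x p] module_inD[OF assms(1), of z p x]
      module_inD[OF assms(2), of z x p] module_inD[OF assms(2), of z p x] assms(3,4) by auto
  show ?thesis
    unfolding module_in_def
  proof (intro conjI ballI impI)
    fix z x y assume "z \<in> A - (M \<union> N)" "x \<in> M \<union> N" "y \<in> M \<union> N" "adj E z x"
    then show "adj E z y" using iff[of z x] iff[of z y] by simp
  next
    show "M \<union> N \<subseteq> A" using module_in_subset assms(1,2) by blast
  qed
qed

text \<open>A vertex \<open>z\<close> of \<open>A\<close> outside the component with a neighbour in
  it must be adjacent to \<open>u\<close>. If \<open>z\<close> saw only part of the component,
  connectedness would give an edge \<open>a\<close>, \<open>b\<close> with only \<open>a\<close>
  adjacent to \<open>z\<close>, and \<open>u, z, a, b\<close> would be an induced path.\<close>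

lemma component_module:
  assumes p: "p \<in> A" "\<not> adj E u p" and P4: "\<not> P4_into E A u"
  shows "module_in E A (component E (A - nbs E A u) p)"
proof -
  let ?C = "component E (A - nbs E A u) p"
  have pU: "p \<in> A - nbs E A u" using p by (simp add: nbs_def)
  have conn: "connected_in E ?C" using component_connected[OF pU] .
  have CU: "?C \<subseteq> A - nbs E A u" using component_subset[OF pU] .
  show ?thesis
    unfolding module_in_def
  proof (intro conjI ballI impI)
    fix z x y assume z: "z \<in> A - ?C" and x: "x \<in> ?C" and y: "y \<in> ?C" and zx: "adj E z x"
    show "adj E z y"
    proof (rule ccontr)
      assume zy: "\<not> adj E z y"
      let ?M = "{x \<in> ?C. adj E z x}"
      have "?M \<subseteq> ?C" "?M \<noteq> {}" "?M \<noteq> ?C" using x y zx zy by blast+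
      then obtain a b where ab: "a \<in> ?M" "b \<in> ?C - ?M" "adj E a b"
        using conn unfolding connected_in_def by meson
      have "adj E u z"
        using component_closed[of a E "A - nbs E A u" p z] ab(1) z adj_commute[of E z a] pU
        by (auto simp: nbs_def)
      moreover have "a \<in> A" "b \<in> A" "\<not> adj E u a" "\<not> adj E u b" using ab CU by (auto simp: nbs_def)
      ultimately have "P4_into E A u"
        using ab z unfolding P4_into_def by blast
      then show False using P4 by simp
    qed
  qed (use CU in blast)
qed

text \<open>
  The vertices \<open>p\<close> and \<open>q\<close> are the ends of an edge leaving a maximal proper module \<open>M\<close>. If
  no \<open>P\<^sub>4\<close> leads from \<open>u\<close> into \<open>A\<close>, the component of \<open>A\<close> minus the neighbours of \<open>u\<close> that
  contains this edge is a module, so its union with \<open>M\<close> is everything.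
\<close>

lemma neighbourhood_decomposition:
  assumes "finite A" and conn: "connected_in E A"
  shows "\<exists>p\<in>A. \<exists>q\<in>A. \<forall>u. nbs E A u \<noteq> {} \<longrightarrow> \<not> adj E u p \<longrightarrow> \<not> adj E u q \<longrightarrow> \<not> P4_into E A u \<longrightarrow>
    (\<forall>x\<in>nbs E A u. adj E x q)"
proof (cases "\<exists>a. A = {a}")
  case True
  then show ?thesis by (auto simp: nbs_def)
next
  case False
  obtain a where a: "a \<in> A" "A \<noteq> {a}" using conn False by (auto simp: connected_in_def)
  define \<M> where "\<M> = {M. module_in E A M \<and> M \<noteq> {} \<and> M \<noteq> A}"
  have "finite \<M>" using assms(1) by (rule finite_subset[rotated, OF finite_Pow_iff[THEN iffD2]])
    (auto simp: \<M>_def dest: module_in_subset)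
  moreover have "{a} \<in> \<M>" using a by (auto simp: \<M>_def module_in_def)
  ultimately obtain M where M: "M \<in> \<M>" "\<forall>N\<in>\<M>. M \<subseteq> N \<longrightarrow> M = N"
    using finite_has_maximal[of \<M>] by blast
  then have "module_in E A M" "M \<noteq> {}" "M \<noteq> A" "M \<subseteq> A" by (auto simp: \<M>_def dest: module_in_subset)
  then obtain p q where pq: "p \<in> M" "q \<in> A - M" "adj E p q"
    using conn unfolding connected_in_def by blast
  have "adj E x q" if u: "\<not> adj E u p" "\<not> adj E u q" "\<not> P4_into E A u" and x: "x \<in> nbs E A u" for u x
  proof -
    define C where "C = component E (A - nbs E A u) p"
    have p: "p \<in> A" "p \<in> A - nbs E A u" using pq \<open>M \<subseteq> A\<close> u by (auto simp: nbs_def)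
    have C: "module_in E A C" "C \<subseteq> A - nbs E A u"
      using component_module[OF p(1) u(1,3)] component_subset[OF p(2)] by (simp_all add: C_def)
    have "p \<in> C" by (simp add: C_def component_self)
    then have "q \<in> C" using component_closed[of p E _ p q] p(2) pq u(2) by (simp add: C_def nbs_def)
    have "module_in E A (M \<union> C)" using module_in_Un \<open>module_in E A M\<close> C(1) pq(1) \<open>p \<in> C\<close> by metis
    moreover have "M \<union> C \<noteq> M" using \<open>q \<in> C\<close> pq by auto
    ultimately have "M \<union> C = A" using M(2) \<open>M \<noteq> {}\<close> by (auto simp: \<M>_def)
    \<comment> \<open>\<open>x\<close> lies outside \<open>C\<close>, hence in \<open>M\<close>. As
      \<open>q\<close> is outside \<open>M\<close> and adjacent to \<open>p\<close> in
      \<open>M\<close>, it is adjacent to all of \<open>M\<close>.\<close>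
    then have "x \<in> M" using x C(2) by (auto simp: nbs_def)
    then show ?thesis
      using module_inD[OF \<open>module_in E A M\<close> pq(2,1), of x] pq(3) by (simp add: adj_commute)
  qed
  then show ?thesis using pq \<open>M \<subseteq> A\<close> by blast
qed

section \<open>Covering by closed neighbourhoods\<close>

definition covered :: "'a set \<Rightarrow> 'a set set \<Rightarrow> 'a set \<Rightarrow> nat \<Rightarrow> bool" where
  "covered V E T n \<longleftrightarrow> (\<exists>X\<subseteq>V. finite X \<and> card X \<le> n \<and> T \<subseteq> closed_nbhd V E X)"

lemma covered_mono: "covered V E T m \<Longrightarrow> T' \<subseteq> T \<Longrightarrow> m \<le> n \<Longrightarrow> covered V E T' n"
  unfolding covered_def by (meson order_trans)

lemma covered_Un:
  assumes "covered V E T m" "covered V E T' n"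
  shows "covered V E (T \<union> T') (m + n)"
proof -
  obtain X X' where X: "X \<subseteq> V" "finite X" "card X \<le> m" "T \<subseteq> closed_nbhd V E X"
    and X': "X' \<subseteq> V" "finite X'" "card X' \<le> n" "T' \<subseteq> closed_nbhd V E X'"
    using assms by (auto simp: covered_def)
  have "card (X \<union> X') \<le> m + n" using card_Un_le[of X X'] X X' by linarith
  moreover have "T \<union> T' \<subseteq> closed_nbhd V E (X \<union> X')"
    using X X' by (auto simp: closed_nbhd_def open_nbhd_def)
  ultimately show ?thesis using X X' unfolding covered_def
    by (intro exI[of _ "X \<union> X'"]) simp
qed

lemma closed_nbhd_iff:
  assumes "finite_simple_graph V E"
  shows "v \<in> closed_nbhd V E X \<longleftrightarrow> (\<exists>x\<in>X. v = x \<or> adj E x v)"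
proof -
  have "v \<in> V" if "adj E x v" for x using edge_in_V(2)[OF assms that] .
  then show ?thesis unfolding closed_nbhd_def open_nbhd_def adj_def by blast
qed

text \<open>Covering is shown by refutation: no vertex of \<open>T\<close> may be far from all
  chosen centres. Repetitions in the list are harmless, since the cardinality of its set is at most
  its length.\<close>

lemma covered_list:
  assumes "finite_simple_graph V E" "set xs \<subseteq> V"
    and "\<And>w. w \<in> T \<Longrightarrow> (\<And>x. x \<in> set xs \<Longrightarrow> w \<noteq> x \<and> \<not> adj E x w) \<Longrightarrow> False"
  shows "covered V E T (length xs)"
proof -
  have "T \<subseteq> closed_nbhd V E (set xs)" using assms(3) closed_nbhd_iff[OF assms(1)] by blast
  then show ?thesis using assms(2) card_length[of xs] by (auto simp: covered_def)
qed

lemma covered_diff: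
  assumes "finite_simple_graph V E" "set xs \<subseteq> V" "covered V E {w \<in> T. \<forall>x\<in>set xs. w \<noteq> x \<and> \<not> adj E x w} n"
  shows "covered V E T (length xs + n)"
proof -
  let ?R = "{w \<in> T. \<forall>x\<in>set xs. w \<noteq> x \<and> \<not> adj E x w}"
  have "covered V E (T - ?R) (length xs)"
    using assms(1,2) by (rule covered_list) blast
  from covered_Un[OF this assms(3)] show ?thesis by (rule covered_mono) blast+
qed

section \<open>Covering a set between two connected sets\<close>

text \<open>The vertices of the second kind, left over by
  \<open>neighbourhood_decomposition\<close>; its \<open>q\<close> appears here as
  \<open>p\<close>.\<close>

definition tame :: "'a set set \<Rightarrow> 'a set \<Rightarrow> 'a \<Rightarrow> 'a set \<Rightarrow> bool" where
  "tame E A p T \<longleftrightarrow> (\<forall>u\<in>T. \<not> P4_into E A u \<and> nbs E A u \<noteq> {} \<and> \<not> adj E u p \<and>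
     (\<forall>x\<in>nbs E A u. adj E x p))"

text \<open>Otherwise \<open>u, x, p, y\<close> would be a path into \<open>A\<close>.\<close>

lemma tame_private_adj:
  assumes "tame E A p T" "p \<in> A" "u \<in> T" "v \<in> T"
    and x: "x \<in> nbs E A u" "\<not> adj E v x" and y: "y \<in> nbs E A v" "\<not> adj E u y"
  shows "adj E x y"
proof (rule ccontr)
  assume "\<not> adj E x y"
  have "x \<in> A" "y \<in> A" "adj E u x" using x y by (simp_all add: nbs_def)
  moreover have "adj E x p" "adj E p y" "\<not> adj E u p"
    using assms adj_commute[of E p y] by (simp_all add: tame_def)
  ultimately have "P4_into E A u"
    using \<open>\<not> adj E x y\<close> y(2) \<open>p \<in> A\<close> unfolding P4_into_def by blast
  then show False using assms by (simp add: tame_def)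
qed

locale two_sides =
  fixes V :: "'a set" and E :: "'a set set" and A B :: "'a set"
  assumes graph: "finite_simple_graph V E" and P7: "P_free 7 V E"
    and AV: "A \<subseteq> V" and BV: "B \<subseteq> V"
    and AB: "\<And>a b. a \<in> A \<Longrightarrow> b \<in> B \<Longrightarrow> \<not> adj E a b"
begin

lemma flip: "two_sides V E B A"
  using graph P7 AV BV AB adj_commute[of E] by unfold_locales blast+

lemma BA: "b \<in> B \<Longrightarrow> a \<in> A \<Longrightarrow> \<not> adj E b a"
  using AB adj_commute[of E] by blast

lemma not_P4_into_both: "\<not> (P4_into E A u \<and> P4_into E B u)"
proof
  assume "P4_into E A u \<and> P4_into E B u"
  then obtain a b c a' b' c' where A: "a \<in> A" "b \<in> A" "c \<in> A" "adj E u a" "adj E a b" "adj E b c"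
      "\<not> adj E u b" "\<not> adj E u c" "\<not> adj E a c"
    and B: "a' \<in> B" "b' \<in> B" "c' \<in> B" "adj E u a'" "adj E a' b'" "adj E b' c'"
      "\<not> adj E u b'" "\<not> adj E u c'" "\<not> adj E a' c'"
    unfolding P4_into_def by blast
  show False
    by (rule no_P7[OF graph P7, of c b a u a' b' c']) (use A B AB BA in \<open>simp_all add: adj_commute\<close>)
qed

text \<open>A vertex \<open>w\<close> far from the five centres misses \<open>x0\<close>, so by
  minimality \<open>u\<close> and \<open>w\<close> have private neighbours \<open>x\<close> and
  \<open>y\<close> in \<open>A\<close>, which are adjacent. Then
  \<open>w, y, x, u, b, b', b''\<close> is an induced \<open>P_7\<close>.\<close>

lemma covered_minimal_P4:
  assumes T: "tame E A p T" "p \<in> A" "T \<subseteq> V" and u: "u \<in> T" "P4_into E B u"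
    and min: "\<forall>w\<in>T. nbs E A w \<subseteq> nbs E A u \<longrightarrow> nbs E A u \<subseteq> nbs E A w"
  shows "covered V E T 5"
proof -
  obtain b b' b'' where b: "b \<in> B" "b' \<in> B" "b'' \<in> B" "adj E u b" "adj E b b'" "adj E b' b''"
      "\<not> adj E u b'" "\<not> adj E u b''" "\<not> adj E b b''"
    using u(2) unfolding P4_into_def by blast
  have "nbs E A u \<noteq> {}" using T u by (simp add: tame_def)
  then obtain x0 where x0: "x0 \<in> nbs E A u" by blast
  have "covered V E T (length [u, x0, b, b', b''])"
  proof (rule covered_list[OF graph])
    show "set [u, x0, b, b', b''] \<subseteq> V" using T u b x0 AV BV by (auto simp: nbs_def)
  next
    fix w assume w: "w \<in> T" and far: "\<And>x. x \<in> set [u, x0, b, b', b''] \<Longrightarrow> w \<noteq> x \<and> \<not> adj E x w"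
    have nadj: "\<not> adj E u w" "\<not> adj E x0 w" "\<not> adj E b w" "\<not> adj E b' w" "\<not> adj E b'' w"
      using far by auto
    have "\<not> nbs E A u \<subseteq> nbs E A w" using x0 nadj(2) adj_commute[of E x0 w] by (auto simp: nbs_def)
    then obtain x y where "x \<in> nbs E A u" "x \<notin> nbs E A w" "y \<in> nbs E A w" "y \<notin> nbs E A u"
      using min w by blast
    then have x: "x \<in> nbs E A u" "\<not> adj E w x" and y: "y \<in> nbs E A w" "\<not> adj E u y"
      by (simp_all add: nbs_def)
    have "adj E y x" using tame_private_adj[OF T(1,2) w u(1) y x] .
    moreover have "x \<in> A" "y \<in> A" "adj E u x" "adj E w y" using x y by (auto simp: nbs_def)
    ultimately show False
      using x y b nadj AB BA
      by (intro no_P7[OF graph P7, of w y x u b b' b'']) (simp_all add: adj_commute)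
  qed
  then show ?thesis by (simp add: numeral_eq_Suc)
qed

text \<open>For the \<open>u\<close> supplied by \<open>biranking\<close>, every \<open>w\<close>
  contains all of \<open>\<alpha> u\<close> in \<open>\<alpha> w\<close> or all neighbours of
  \<open>u\<close> in \<open>B\<close> among its own, so one vertex of each kind suffices. The
  function \<alpha> allows for neighbourhoods in \<open>A\<close> from which a fixed part was
  removed.\<close>

lemma covered_comparable:
  assumes "finite T" and sub: "\<And>w. w \<in> T \<Longrightarrow> \<alpha> w \<subseteq> nbs E A w \<and> \<alpha> w \<noteq> {} \<and> nbs E B w \<noteq> {}"
    and comp: "\<forall>v\<in>T. \<forall>w\<in>T. \<alpha> v \<subseteq> \<alpha> w \<or> \<alpha> w \<subseteq> \<alpha> v \<or> nbs E B v \<subseteq> nbs E B w \<or> nbs E B w \<subseteq> nbs E B v"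
  shows "covered V E T 2"
proof (cases "T = {}")
  case True
  then show ?thesis by (auto simp: covered_def)
next
  case False
  obtain u where u: "u \<in> T" "\<forall>w\<in>T. \<alpha> u \<subseteq> \<alpha> w \<or> nbs E B u \<subseteq> nbs E B w"
    using biranking[OF assms(1) False comp] by blast
  obtain a b where ab: "a \<in> \<alpha> u" "b \<in> nbs E B u" using sub[OF u(1)] by blast
  have "covered V E T (length [a, b])"
  proof (rule covered_list[OF graph])
    show "set [a, b] \<subseteq> V" using ab sub[OF u(1)] AV BV by (auto simp: nbs_def)
  next
    fix w assume w: "w \<in> T" and far: "\<And>x. x \<in> set [a, b] \<Longrightarrow> w \<noteq> x \<and> \<not> adj E x w"
    then have "a \<in> nbs E A w \<or> b \<in> nbs E B w" using u(2) ab sub[OF w] by blast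
    then show False using far[of a] far[of b] adj_commute[of E w] by (auto simp: nbs_def)
  qed
  then show ?thesis by (simp add: numeral_eq_Suc)
qed

text \<open>
  Removing the neighbours of four vertices of a suitable induced six-cycle through both sides
  leaves only pairs that are comparable on one of the two sides.
\<close>

lemma covered_tame_both:
  assumes W: "tame E A p W" "p \<in> A" "tame E B q W" "q \<in> B" "W \<subseteq> V" "finite W"
    and \<alpha>: "\<And>w. \<alpha> w = nbs E A w - X" "\<And>w. w \<in> W \<Longrightarrow> \<alpha> w \<noteq> {}"
    and eq: "\<And>v w. v \<in> W \<Longrightarrow> w \<in> W \<Longrightarrow> adj E v w \<Longrightarrow> \<alpha> v = \<alpha> w"
  shows "covered V E W 6"
proof -
  define bad where "bad v w \<longleftrightarrow> \<not> \<alpha> v \<subseteq> \<alpha> w \<and> \<not> \<alpha> w \<subseteq> \<alpha> v \<and>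
    \<not> nbs E B v \<subseteq> nbs E B w \<and> \<not> nbs E B w \<subseteq> nbs E B v" for v w
  have no_bad: "covered V E T 2" if "T \<subseteq> W" "\<And>v w. v \<in> T \<Longrightarrow> w \<in> T \<Longrightarrow> \<not> bad v w" for T
  proof (rule covered_comparable[where \<alpha> = \<alpha>])
    show "finite T" using that W finite_subset by blast
    show "\<alpha> w \<subseteq> nbs E A w \<and> \<alpha> w \<noteq> {} \<and> nbs E B w \<noteq> {}" if "w \<in> T" for w
      using \<alpha>(1)[of w] \<alpha>(2)[of w] W(3) that \<open>T \<subseteq> W\<close> by (auto simp: tame_def)
    show "\<forall>v\<in>T. \<forall>w\<in>T. \<alpha> v \<subseteq> \<alpha> w \<or> \<alpha> w \<subseteq> \<alpha> v \<or> nbs E B v \<subseteq> nbs E B w \<or> nbs E B w \<subseteq> nbs E B v"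
      using that(2) unfolding bad_def by blast
  qed
  define P where "P = {(v, w) \<in> W \<times> W. bad v w}"
  show ?thesis
  proof (cases "P = {}")
    case True
    then have "covered V E W 2" by (intro no_bad) (auto simp: P_def)
    then show ?thesis by (rule covered_mono) auto
  next
    case False
    have "finite P" by (rule finite_subset[of _ "W \<times> W"]) (use W in \<open>auto simp: P_def\<close>)
    \<comment> \<open>Among the bad pairs take one with minimal union of \<alpha>. Vertices far from
      the four centres have \<alpha> inside this union without \<open>y\<close>, so a bad pair among
      them would contradict minimality.\<close>
    from ex_minimal_set[OF this False, of "\<lambda>(v, w). \<alpha> v \<union> \<alpha> w"]
    obtain v v' where P: "(v, v') \<in> P"
      and min: "\<And>w w'. (w, w') \<in> P \<Longrightarrow> \<alpha> w \<union> \<alpha> w' \<subseteq> \<alpha> v \<union> \<alpha> v' \<Longrightarrow> \<alpha> v \<union> \<alpha> v' \<subseteq> \<alpha> w \<union> \<alpha> w'"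
      by fastforce
    have v: "v \<in> W" "v' \<in> W" using P by (auto simp: P_def)
    obtain y y' b b' where y: "y \<in> \<alpha> v" "y \<notin> \<alpha> v'" "y' \<in> \<alpha> v'" "y' \<notin> \<alpha> v"
      and b: "b \<in> nbs E B v" "b \<notin> nbs E B v'" "b' \<in> nbs E B v'" "b' \<notin> nbs E B v"
      using P unfolding P_def bad_def by blast
    have yA: "y \<in> A" "y' \<in> A" "adj E v y" "adj E v' y'" "\<not> adj E v' y" "\<not> adj E v y'"
      using y by (auto simp: \<alpha> nbs_def)
    have bB: "b \<in> B" "b' \<in> B" "adj E v b" "adj E v' b'" "\<not> adj E v' b" "\<not> adj E v b'"
      using b by (auto simp: nbs_def)
    have "\<not> adj E v v'" using eq v y by blast
    have "adj E b b'" using tame_private_adj[OF W(3,4) v b(1) bB(5) b(3) bB(6)] .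
    let ?W' = "{w \<in> W. \<forall>x\<in>set [y, y', b, b']. w \<noteq> x \<and> \<not> adj E x w}"
    \<comment> \<open>A vertex \<open>x\<close> of \<open>\<alpha> w\<close> outside the union lies
      outside \<open>X\<close>, so it is adjacent to neither \<open>v\<close> nor \<open>v'\<close>.
      As private neighbours \<open>x\<close> and \<open>y\<close> are adjacent, and
      \<open>w, x, y, v, b, b', v'\<close> is an induced \<open>P_7\<close>.\<close>
    have sub: "\<alpha> w \<subseteq> (\<alpha> v \<union> \<alpha> v') - {y}" if w: "w \<in> ?W'" for w
    proof -
      have nadj: "\<not> adj E w y" "\<not> adj E w y'" "\<not> adj E w b" "\<not> adj E w b'"
        using w adj_commute[of E w] by auto
      have "y \<notin> \<alpha> w" "y' \<notin> \<alpha> w" using nadj by (auto simp: \<alpha> nbs_def)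
      then have "\<alpha> v \<noteq> \<alpha> w" "\<alpha> v' \<noteq> \<alpha> w" using y by auto
      then have wv: "\<not> adj E v w" "\<not> adj E v' w" using eq v w by auto
      have "x \<in> \<alpha> v \<union> \<alpha> v'" if x: "x \<in> \<alpha> w" for x
      proof (rule ccontr)
        assume "x \<notin> \<alpha> v \<union> \<alpha> v'"
        then have x': "x \<in> A" "adj E w x" "\<not> adj E v x" "\<not> adj E v' x"
          using x by (auto simp: \<alpha> nbs_def)
        have "adj E x y"
          using tame_private_adj[OF W(1,2) _ v(1), of w x y] w x x' y nadj by (simp add: \<alpha>)
        then show False
          using x' wv nadj yA bB \<open>adj E b b'\<close> \<open>\<not> adj E v v'\<close> AB BA
          by (intro no_P7[OF graph P7, of w x y v b b' v']) (simp_all add: adj_commute)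
      qed
      then show ?thesis using \<open>y \<notin> \<alpha> w\<close> by blast
    qed
    have "covered V E ?W' 2"
    proof (rule no_bad)
      fix w w' assume w: "w \<in> ?W'" "w' \<in> ?W'"
      then have "\<not> \<alpha> v \<union> \<alpha> v' \<subseteq> \<alpha> w \<union> \<alpha> w'" "\<alpha> w \<union> \<alpha> w' \<subseteq> \<alpha> v \<union> \<alpha> v'"
        using sub[OF w(1)] sub[OF w(2)] y(1) by blast+
      then show "\<not> bad w w'" using min[of w w'] w by (auto simp: P_def)
    qed auto
    then have "covered V E W (length [y, y', b, b'] + 2)"
      by (intro covered_diff[OF graph]) (use yA bB AV BV in auto)
    then show ?thesis by (simp add: numeral_eq_Suc)
  qed
qed

text \<open>Let \<open>u\<close> have minimal neighbourhood in \<open>A\<close>. If \<open>u\<close>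
  is not in \<open>Z'\<close>, it starts an induced \<open>P_4\<close> into \<open>B\<close> and
  five centres suffice. Otherwise \<open>u\<close>, \<open>x0\<close>, \<open>b0\<close> are spent
  and \<alpha> keeps the neighbours in \<open>A\<close> private against \<open>u\<close>. It is
  nonempty by minimality and equal for adjacent vertices, which gives 6 for the part in
  \<open>Z'\<close> and 4 for the rest.\<close>

lemma covered_tame:
  assumes Z: "tame E A p Z" "p \<in> A" "Z \<subseteq> V" "finite Z"
    and Z': "tame E B q Z'" "q \<in> B"
    and far_q: "\<And>u. u \<in> Z \<Longrightarrow> \<not> adj E u q"
    and P4: "\<And>u. u \<in> Z - Z' \<Longrightarrow> P4_into E B u"
  shows "covered V E Z 13"
proof (cases "Z = {}")
  case True
  then show ?thesis by (auto simp: covered_def)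
next
  case False
  obtain u where u: "u \<in> Z" and min: "\<forall>w\<in>Z. nbs E A w \<subseteq> nbs E A u \<longrightarrow> nbs E A u \<subseteq> nbs E A w"
    using ex_minimal_set[OF Z(4) False, of "nbs E A"] by blast
  show ?thesis
  proof (cases "u \<in> Z'")
    case False
    then have "covered V E Z 5" using covered_minimal_P4[OF Z(1-3) u P4 min] u by simp
    then show ?thesis by (rule covered_mono) auto
  next
    case uZ': True
    have "nbs E A u \<noteq> {}" "nbs E B u \<noteq> {}" using Z(1) Z'(1) u uZ' by (simp_all add: tame_def)
    then obtain x0 b0 where x0: "x0 \<in> nbs E A u" and b0: "b0 \<in> nbs E B u" by blast
    have x0': "x0 \<in> A" "adj E u x0" using x0 by (simp_all add: nbs_def)
    have b0': "b0 \<in> B" "adj E u b0" "adj E b0 q" "\<not> adj E u q"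
      using b0 Z'(1) uZ' by (simp_all add: nbs_def tame_def)
    let ?W = "{w \<in> Z. \<forall>x\<in>set [u, x0, b0]. w \<noteq> x \<and> \<not> adj E x w}"
    define \<alpha> where "\<alpha> w = nbs E A w - nbs E A u" for w
    have W: "w \<in> Z" "\<not> adj E u w" "\<not> adj E x0 w" "\<not> adj E b0 w" if "w \<in> ?W" for w
      using that by auto
    have \<alpha>: "\<alpha> w \<noteq> {}" if "w \<in> ?W" for w
    proof
      assume "\<alpha> w = {}"
      then have "x0 \<in> nbs E A w" using min W(1)[OF that] x0 by (auto simp: \<alpha>_def)
      then show False using W(3)[OF that] adj_commute[of E w] by (simp add: nbs_def)
    qed
    \<comment> \<open>Otherwise \<open>q, b\<^sub>0, u, x\<^sub>0, y, v, w\<close> is a path for every \<open>y\<close> in the difference.\<close>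
    have sub: "\<alpha> v \<subseteq> \<alpha> w" if v: "v \<in> ?W" and w: "w \<in> ?W" and vw: "adj E v w" for v w
    proof
      fix y assume y: "y \<in> \<alpha> v"
      then have y': "y \<in> A" "adj E v y" "\<not> adj E u y" by (auto simp: \<alpha>_def nbs_def)
      have "adj E y x0"
        using tame_private_adj[OF Z(1,2) W(1)[OF v] u _ _ x0, of y] y y'(3) W(3)[OF v] adj_commute[of E v]
        by (simp add: \<alpha>_def)
      have "adj E w y"
      proof (rule ccontr)
        assume "\<not> adj E w y"
        then show False
          using y' x0' b0' W[OF v] W[OF w] far_q[OF W(1)[OF v]] far_q[OF W(1)[OF w]] vw \<open>adj E y x0\<close> \<open>q \<in> B\<close> AB BA
          by (intro no_P7[OF graph P7, of q b0 u x0 y v w]) (simp_all add: adj_commute)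
      qed
      then show "y \<in> \<alpha> w" using y by (simp add: \<alpha>_def nbs_def)
    qed
    have eq: "\<alpha> v = \<alpha> w" if "v \<in> ?W" "w \<in> ?W" "adj E v w" for v w
      using sub[OF that] sub[OF that(2,1)] that(3) adj_commute[of E v w] by auto
    have "covered V E (?W \<inter> Z') 6"
    proof (rule covered_tame_both[of p _ q \<alpha> "nbs E A u"])
      show "tame E A p (?W \<inter> Z')" "tame E B q (?W \<inter> Z')" using Z(1) Z'(1) by (auto simp: tame_def)
    qed (use Z Z' \<alpha> eq in \<open>auto simp: \<alpha>_def\<close>)
    moreover have "covered V E (?W - Z') 4"
    proof (cases "?W - Z' = {}")
      case True
      then show ?thesis by (auto simp: covered_def)
    next
      case False
      have "finite (?W - Z')" using Z(4) by simp
      from ex_minimal_set[OF this False, of \<alpha>]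
      obtain v where v: "v \<in> ?W" "v \<notin> Z'" and vmin: "\<And>w. w \<in> ?W - Z' \<Longrightarrow> \<alpha> w \<subseteq> \<alpha> v \<Longrightarrow> \<alpha> v \<subseteq> \<alpha> w"
        by blast
      obtain y where y: "y \<in> \<alpha> v" using \<alpha>[OF v(1)] by blast
      have "P4_into E B v" using P4 W(1)[OF v(1)] v(2) by blast
      then obtain b b' b'' where b: "b \<in> B" "b' \<in> B" "b'' \<in> B" "adj E v b" "adj E b b'" "adj E b' b''"
          "\<not> adj E v b'" "\<not> adj E v b''" "\<not> adj E b b''"
        unfolding P4_into_def by blast
      have yA: "y \<in> A" using y by (simp add: \<alpha>_def nbs_def)
      have "covered V E (?W - Z') (length [y, b, b', b''])"
      proof (rule covered_list[OF graph])
        show "set [y, b, b', b''] \<subseteq> V" using yA b AV BV by auto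
      next
        fix w assume w: "w \<in> ?W - Z'" and far: "\<And>x. x \<in> set [y, b, b', b''] \<Longrightarrow> w \<noteq> x \<and> \<not> adj E x w"
        have nadj: "\<not> adj E y w" "\<not> adj E b w" "\<not> adj E b' w" "\<not> adj E b'' w"
          using far by auto
        have wW: "w \<in> ?W" using w by blast
        have "y \<notin> \<alpha> w" using nadj(1) adj_commute[of E y w] by (simp add: \<alpha>_def nbs_def)
        \<comment> \<open>As \<open>y\<close> is in \<open>\<alpha> v\<close> but not in
          \<open>\<alpha> w\<close>, equality of \<alpha> on adjacent vertices excludes an edge
          between \<open>v\<close> and \<open>w\<close>, and minimality gives a \<open>y'\<close>
          for the path \<open>w, y', y, v, b, b', b''\<close>.\<close>
        then have "\<not> \<alpha> w \<subseteq> \<alpha> v" "\<not> adj E v w" using vmin[OF w] eq[OF v(1) wW] y by auto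
        then obtain y' where y': "y' \<in> \<alpha> w" "y' \<notin> \<alpha> v" by blast
        have 1: "y' \<in> nbs E A w" "\<not> adj E v y'" "y \<in> nbs E A v" "\<not> adj E w y"
          using y y' \<open>y \<notin> \<alpha> w\<close> by (auto simp: \<alpha>_def nbs_def)
        have "adj E y' y" using tame_private_adj[OF Z(1,2) W(1)[OF wW] W(1)[OF v(1)] 1] .
        moreover have "y' \<in> A" "adj E w y'" "adj E v y" using 1 by (simp_all add: nbs_def)
        ultimately show False
          using 1 b nadj \<open>\<not> adj E v w\<close> yA AB BA
          by (intro no_P7[OF graph P7, of w y' y v b b' b'']) (simp_all add: adj_commute)
      qed
      then show ?thesis by (simp add: numeral_eq_Suc)
    qed
    ultimately have "covered V E (?W \<inter> Z' \<union> (?W - Z')) (6 + 4)" by (rule covered_Un)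
    then have "covered V E ?W 10" by (rule covered_mono) auto
    then have "covered V E Z (length [u, x0, b0] + 10)"
      by (intro covered_diff[OF graph]) (use x0' b0' u Z(3) AV BV in auto)
    then show ?thesis by (simp add: numeral_eq_Suc)
  qed
qed

text \<open>Four centres come from the decompositions of \<open>A\<close> and \<open>B\<close>. No
  remaining vertex starts an induced \<open>P_4\<close> into both sides, so it lies in
  \<open>ZA\<close>, at cost 13, or in \<open>ZB - ZA\<close>. Vertices of the latter start a
  \<open>P_4\<close> into \<open>A\<close>, so \<open>covered_minimal_P4\<close> with the sides
  exchanged gives 5.\<close>

lemma covered_between:
  assumes "connected_in E A" "connected_in E B" "S \<subseteq> V"
    and full: "\<And>s. s \<in> S \<Longrightarrow> nbs E A s \<noteq> {} \<and> nbs E B s \<noteq> {}"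
  shows "covered V E S 22"
proof -
  have fin: "finite V" using graph by (simp add: finite_simple_graph_def)
  then have "finite A" "finite B" "finite S" using AV BV assms(3) finite_subset by blast+
  obtain p p' where p: "p \<in> A" "p' \<in> A"
    and A: "\<And>u x. nbs E A u \<noteq> {} \<Longrightarrow> \<not> adj E u p' \<Longrightarrow> \<not> adj E u p \<Longrightarrow> \<not> P4_into E A u \<Longrightarrow>
      x \<in> nbs E A u \<Longrightarrow> adj E x p"
    using neighbourhood_decomposition[OF \<open>finite A\<close> assms(1)] by blast
  obtain q q' where q: "q \<in> B" "q' \<in> B"
    and B: "\<And>u x. nbs E B u \<noteq> {} \<Longrightarrow> \<not> adj E u q' \<Longrightarrow> \<not> adj E u q \<Longrightarrow> \<not> P4_into E B u \<Longrightarrow>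
      x \<in> nbs E B u \<Longrightarrow> adj E x q"
    using neighbourhood_decomposition[OF \<open>finite B\<close> assms(2)] by blast
  let ?S = "{s \<in> S. \<forall>x\<in>set [p, p', q, q']. s \<noteq> x \<and> \<not> adj E x s}"
  have S: "s \<in> S" "\<not> adj E s p" "\<not> adj E s p'" "\<not> adj E s q" "\<not> adj E s q'" if "s \<in> ?S" for s
    using that adj_commute[of E s] by auto
  define ZA where "ZA = {s \<in> ?S. \<not> P4_into E A s}"
  define ZB where "ZB = {s \<in> ?S. \<not> P4_into E B s}"
  have ZA: "tame E A p ZA" using S A full unfolding tame_def ZA_def by blast
  have ZB: "tame E B q ZB" using S B full unfolding tame_def ZB_def by blast
  have "covered V E ZA 13"
    by (rule covered_tame[OF ZA p(1) _ _ ZB q(1)])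
      (use S(4) \<open>S \<subseteq> V\<close> \<open>finite S\<close> in \<open>auto simp: ZA_def ZB_def\<close>)
  moreover have "covered V E (ZB - ZA) 5"
  proof (cases "ZB - ZA = {}")
    case True
    then show ?thesis by (auto simp: covered_def)
  next
    case False
    interpret flip: two_sides V E B A by (rule flip)
    have "finite (ZB - ZA)" using \<open>finite S\<close> by (simp add: ZB_def)
    from ex_minimal_set[OF this False, of "nbs E B"]
    obtain u where u: "u \<in> ZB - ZA" "\<forall>w\<in>ZB - ZA. nbs E B w \<subseteq> nbs E B u \<longrightarrow> nbs E B u \<subseteq> nbs E B w"
      by blast
    show ?thesis
    proof (rule flip.covered_minimal_P4[OF _ q(1) _ u(1) _ u(2)])
      show "tame E B q (ZB - ZA)" using ZB unfolding tame_def by blast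
      show "ZB - ZA \<subseteq> V" "P4_into E A u" using u \<open>S \<subseteq> V\<close> by (auto simp: ZA_def ZB_def)
    qed
  qed
  ultimately have "covered V E (ZA \<union> (ZB - ZA)) (13 + 5)" by (rule covered_Un)
  moreover have "?S \<subseteq> ZA \<union> (ZB - ZA)"
    using not_P4_into_both by (auto simp: ZA_def ZB_def)
  ultimately have "covered V E ?S 18" by (rule covered_mono) simp
  then have "covered V E S (length [p, p', q, q'] + 18)"
    by (intro covered_diff[OF graph]) (use p q AV BV in auto)
  then show ?thesis by (simp add: numeral_eq_Suc)
qed

end

section \<open>Shortest connecting paths\<close>

lemma ipathI:
  assumes "\<And>i j. i < j \<Longrightarrow> j < length xs \<Longrightarrow> xs ! i \<noteq> xs ! j \<and> (adj E (xs ! i) (xs ! j) \<longleftrightarrow> j = Suc i)"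
  shows "ipath E xs"
  using assms
proof (induction xs)
  case (Cons x xs)
  have "ipath E xs"
  proof (rule Cons.IH)
    fix i j assume "i < j" "j < length xs"
    then show "xs ! i \<noteq> xs ! j \<and> (adj E (xs ! i) (xs ! j) \<longleftrightarrow> j = Suc i)"
      using Cons.prems[of "Suc i" "Suc j"] by simp
  qed
  moreover have "x \<noteq> y \<and> (adj E x y \<longleftrightarrow> y = hd xs)" if y: "y \<in> set xs" for y
  proof -
    obtain j where j: "j < length xs" "y = xs ! j" using y by (auto simp: in_set_conv_nth)
    have "x \<noteq> y" "adj E x y \<longleftrightarrow> j = 0" using Cons.prems[of 0 "Suc j"] j by auto
    moreover have "y = hd xs \<longleftrightarrow> j = 0"
      using j ipath_distinct[OF \<open>ipath E xs\<close>] by (cases xs) (auto simp: nth_Cons split: nat.splits)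
    ultimately show ?thesis by simp
  qed
  ultimately show ?case by auto
qed simp

definition walk_between :: "'a set set \<Rightarrow> 'a set \<Rightarrow> 'a set \<Rightarrow> 'a set \<Rightarrow> 'a list \<Rightarrow> bool" where
  "walk_between E D X Y xs \<longleftrightarrow> xs \<noteq> [] \<and> set xs \<subseteq> D \<and> successively (adj E) xs \<and> hd xs \<in> X \<and> last xs \<in> Y"

lemma walk_between_take:
  assumes "walk_between E D X Y xs" "i < length xs" "xs ! i \<in> Y"
  shows "walk_between E D X Y (take (Suc i) xs)"
proof -
  have "successively (adj E) (take (Suc i) xs @ drop (Suc i) xs)"
    using assms(1) by (simp add: walk_between_def)
  then have "successively (adj E) (take (Suc i) xs)" by (simp only: successively_append_iff)
  moreover have "last (take (Suc i) xs) = xs ! i" using assms(2) by (simp add: take_Suc_conv_app_nth)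
  ultimately show ?thesis using assms set_take_subset[of "Suc i" xs] by (auto simp: walk_between_def)
qed

lemma walk_between_drop:
  assumes "walk_between E D X Y xs" "i < length xs" "xs ! i \<in> X"
  shows "walk_between E D X Y (drop i xs)"
proof -
  have "successively (adj E) (take i xs @ drop i xs)"
    using assms(1) by (simp add: walk_between_def)
  then have "successively (adj E) (drop i xs)" by (simp only: successively_append_iff)
  then show ?thesis using assms set_drop_subset[of i xs] by (auto simp: walk_between_def hd_drop_conv_nth)
qed

lemma walk_between_shortcut:
  assumes "walk_between E D X Y xs" "i < j" "j < length xs" "adj E (xs ! i) (xs ! j)"
  shows "walk_between E D X Y (take (Suc i) xs @ drop j xs)"
proof -
  have "successively (adj E) (take (Suc i) xs @ drop (Suc i) xs)" "successively (adj E) (take j xs @ drop j xs)"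
    using assms(1) by (simp_all add: walk_between_def)
  then have "successively (adj E) (take (Suc i) xs)" "successively (adj E) (drop j xs)"
    by (simp_all only: successively_append_iff)
  moreover have "last (take (Suc i) xs) = xs ! i" using assms by (simp add: take_Suc_conv_app_nth)
  moreover have "hd (drop j xs) = xs ! j" using assms by (simp add: hd_drop_conv_nth)
  ultimately have "successively (adj E) (take (Suc i) xs @ drop j xs)"
    using assms(4) by (simp add: successively_append_iff)
  then show ?thesis
    using assms set_take_subset[of "Suc i" xs] set_drop_subset[of j xs]
    by (auto simp: walk_between_def)
qed

lemma ex_walk_between:
  assumes "connected_in E D" "X \<inter> D \<noteq> {}" "Y \<inter> D \<noteq> {}"
  shows "\<exists>xs. walk_between E D X Y xs"
proof -
  let ?M = "{z \<in> D. \<exists>xs. walk_between E D X {z} xs}"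
  have "?M = D"
  proof (rule ccontr)
    assume "?M \<noteq> D"
    obtain x where "x \<in> X" "x \<in> D" using assms by blast
    then have "walk_between E D X {x} [x]" by (simp add: walk_between_def)
    then have "?M \<noteq> {}" using \<open>x \<in> D\<close> by blast
    then obtain p q where pq: "p \<in> ?M" "q \<in> D - ?M" "adj E p q"
      using assms(1) \<open>?M \<noteq> D\<close> unfolding connected_in_def by (metis (no_types, lifting) mem_Collect_eq subsetI)
    then obtain xs where "walk_between E D X {p} xs" by blast
    then have "walk_between E D X {q} (xs @ [q])"
      using pq by (auto simp: walk_between_def successively_append_iff)
    then show False using pq by blast
  qed
  then obtain z xs where "z \<in> Y" "walk_between E D X {z} xs" using assms(3) by blast
  then show ?thesis by (auto simp: walk_between_def)
qed

text \<open>A shortest walk in \<open>D\<close> from \<open>X\<close> to \<open>Y\<close>: meeting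
  \<open>X\<close> later, meeting \<open>Y\<close> earlier or having a chord would allow a shorter
  one.\<close>

lemma connecting_path:
  assumes "connected_in E D" "X \<inter> D \<noteq> {}" "Y \<inter> D \<noteq> {}" and loopless: "\<And>x. \<not> adj E x x"
  obtains xs where "xs \<noteq> []" "set xs \<subseteq> D" "ipath E xs" "hd xs \<in> X" "last xs \<in> Y"
    "\<And>x. x \<in> set xs \<Longrightarrow> x \<in> X \<Longrightarrow> x = hd xs" "\<And>y. y \<in> set xs \<Longrightarrow> y \<in> Y \<Longrightarrow> y = last xs"
proof -
  obtain xs where xs: "walk_between E D X Y xs"
    and least: "\<And>ys. walk_between E D X Y ys \<Longrightarrow> length xs \<le> length ys"
    using ex_has_least_nat[of "walk_between E D X Y" _ length] ex_walk_between[OF assms(1-3)] by blast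
  have X: "i = 0" if "i < length xs" "xs ! i \<in> X" for i
    using least[OF walk_between_drop[OF xs that]] that by auto
  have Y: "Suc i = length xs" if "i < length xs" "xs ! i \<in> Y" for i
    using least[OF walk_between_take[OF xs that]] that by auto
  have short: "j = Suc i" if "i < j" "j < length xs" "adj E (xs ! i) (xs ! j)" for i j
    using least[OF walk_between_shortcut[OF xs that]] that by auto
  have step: "adj E (xs ! i) (xs ! Suc i)" if "Suc i < length xs" for i
    using xs that unfolding walk_between_def successively_conv_nth by blast
  have "ipath E xs"
  proof (rule ipathI)
    fix i j assume ij: "i < j" "j < length xs"
    have "xs ! i \<noteq> xs ! j"
    proof
      \<comment> \<open>If \<open>j\<close> is the last position, \<open>Y\<close> is met already at
        \<open>i\<close>; otherwise the successor of position \<open>j\<close> is adjacent to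
        position \<open>i\<close>, which is a forbidden shortcut.\<close>
      assume eq: "xs ! i = xs ! j"
      show False
      proof (cases "Suc j = length xs")
        case True
        then have "j = length xs - 1" by simp
        then have "xs ! j \<in> Y" using xs last_conv_nth[of xs] by (simp add: walk_between_def)
        then show False using Y[of i] eq ij True by simp
      next
        case False
        then have "adj E (xs ! i) (xs ! Suc j)" using step[of j] eq ij by simp
        then show False using short[of i "Suc j"] ij False by simp
      qed
    qed
    then show "xs ! i \<noteq> xs ! j \<and> (adj E (xs ! i) (xs ! j) \<longleftrightarrow> j = Suc i)"
      using short[OF ij] step[of i] ij by blast
  qed
  moreover have "x = hd xs" if "x \<in> set xs" "x \<in> X" for x
    using that X xs by (auto simp: in_set_conv_nth hd_conv_nth walk_between_def)
  moreover have "y = last xs" if y: "y \<in> set xs" "y \<in> Y" for y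
  proof -
    have "xs \<noteq> []" using xs by (simp add: walk_between_def)
    from y(1) obtain i where i: "i < length xs" "xs ! i = y" unfolding in_set_conv_nth by blast
    then have "i = length xs - 1" using Y[of i] y(2) by simp
    then show ?thesis using i(2) last_conv_nth[OF \<open>xs \<noteq> []\<close>] by simp
  qed
  ultimately show ?thesis using that[of xs] xs by (auto simp: walk_between_def)
qed

text \<open>Prolongs \<open>ys\<close> at its front through \<open>D\<close>. A connecting path
  between the neighbours of \<open>a\<close> and those of \<open>hd ys\<close> meets each of the two
  sets at one end only, which makes the result induced.\<close>

lemma path_through:
  assumes ys: "ipath E ys" "ys \<noteq> []" and D: "connected_in E D" "nbs E D a \<noteq> {}" "nbs E D (hd ys) \<noteq> {}"
    and D_ys: "D \<inter> set ys = {}" "\<And>d z. d \<in> D \<Longrightarrow> z \<in> set (tl ys) \<Longrightarrow> \<not> adj E d z"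
    and a: "a \<notin> D" "a \<notin> set ys" "\<And>z. z \<in> set ys \<Longrightarrow> \<not> adj E a z"
    and loopless: "\<And>x. \<not> adj E x x"
  obtains xs where "xs \<noteq> []" "set xs \<subseteq> D" "ipath E (a # xs @ ys)"
proof -
  obtain xs where xs: "xs \<noteq> []" "set xs \<subseteq> D" "ipath E xs" "hd xs \<in> nbs E D a" "last xs \<in> nbs E D (hd ys)"
    "\<And>x. x \<in> set xs \<Longrightarrow> x \<in> nbs E D a \<Longrightarrow> x = hd xs"
    "\<And>y. y \<in> set xs \<Longrightarrow> y \<in> nbs E D (hd ys) \<Longrightarrow> y = last xs"
    using connecting_path[OF D(1) _ _ loopless, of "nbs E D a" "nbs E D (hd ys)"] D(2,3)
    by (metis (no_types, lifting) Int_absorb2 mem_Collect_eq nbs_def subsetI)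
  have "adj E x y \<longleftrightarrow> x = last xs \<and> y = hd ys" if x: "x \<in> set xs" and y: "y \<in> set ys" for x y
  proof (cases "y = hd ys")
    case True
    have "adj E x y \<longleftrightarrow> x \<in> nbs E D (hd ys)"
      using x xs(2) True adj_commute[of E x y] by (auto simp: nbs_def)
    then show ?thesis using xs(5) xs(7)[OF x] True by auto
  next
    case False
    then have "y \<in> set (tl ys)" using y by (cases ys) auto
    then show ?thesis using D_ys(2)[of x y] x xs(2) False by blast
  qed
  then have "ipath E (xs @ ys)"
    using xs(1-3) ys D_ys(1) by (subst ipath_append) auto
  moreover have "adj E a z \<longleftrightarrow> z = hd (xs @ ys)" if z: "z \<in> set (xs @ ys)" for z
  proof (cases "z \<in> set xs")
    case True
    have "adj E a z \<longleftrightarrow> z \<in> nbs E D a" using True xs(2) by (auto simp: nbs_def)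
    then show ?thesis using xs(1) xs(4) xs(6)[OF True] by auto
  next
    case False
    then have "z \<in> set ys" using z by simp
    moreover have "z \<noteq> hd xs" using False xs(1) by auto
    ultimately show ?thesis using a(3) xs(1) by simp
  qed
  ultimately have "ipath E (a # xs @ ys)" using a(1,2) xs(2) by auto
  then show ?thesis using that xs(1,2) by blast
qed

section \<open>Holes and chordality\<close>

text \<open>An induced cycle on at least four vertices, split into one vertex and the induced path
  formed by the others.\<close>

definition hole :: "'a set set \<Rightarrow> 'a \<Rightarrow> 'a list \<Rightarrow> bool" where
  "hole E v xs \<longleftrightarrow> ipath E xs \<and> 3 \<le> length xs \<and> v \<notin> set xs \<and>
     (\<forall>y\<in>set xs. adj E v y \<longleftrightarrow> y = hd xs \<or> y = last xs)"

lemma cycle_edges_iff: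
  assumes "i < k" "j < k"
  shows "{i, j} \<in> cycle_edges k \<longleftrightarrow> j = Suc i mod k \<or> i = Suc j mod k"
  using assms by (auto simp: cycle_edges_def doubleton_eq_iff)

lemma chordal_no_hole:
  assumes "chordal V E" "hole E v xs" "insert v (set xs) \<subseteq> V" and loopless: "\<And>x. \<not> adj E x x"
  shows False
proof -
  let ?k = "Suc (length xs)"
  let ?f = "\<lambda>i. (v # xs) ! i"
  have xs: "ipath E xs" "3 \<le> length xs" "v \<notin> set xs" "distinct (v # xs)"
    and v: "\<And>y. y \<in> set xs \<Longrightarrow> adj E v y \<longleftrightarrow> y = hd xs \<or> y = last xs"
    using assms(2) ipath_distinct by (auto simp: hole_def)
  have ordered: "adj E (?f i) (?f j) \<longleftrightarrow> j = Suc i mod ?k \<or> i = Suc j mod ?k" if ij: "i < j" "j < ?k" for i j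
  proof -
    obtain j' where j: "j = Suc j'" using ij by (cases j) auto
    have "xs \<noteq> []" "distinct xs" "j' < length xs" using ij j xs by auto
    then have "xs ! j' = hd xs \<longleftrightarrow> j' = 0" "xs ! j' = last xs \<longleftrightarrow> j' = length xs - 1"
      by (simp_all add: hd_conv_nth last_conv_nth nth_eq_iff_index_eq)
    moreover have "j' = length xs - 1 \<longleftrightarrow> Suc j' = length xs" using \<open>j' < length xs\<close> by linarith
    ultimately have "xs ! j' = hd xs \<longleftrightarrow> j' = 0" "xs ! j' = last xs \<longleftrightarrow> Suc j' = length xs"
      by simp_all
    then show ?thesis
      using ij j v[of "xs ! j'"] ipath_nth_less[OF xs(1), of "i - 1" j'] xs(2)
      by (cases i) (auto simp: mod_Suc)
  qed
  have "{i, j} \<in> cycle_edges ?k \<longleftrightarrow> {?f i, ?f j} \<in> induced_edges E (insert v (set xs))"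
    if ij: "i < ?k" "j < ?k" for i j
  proof -
    have mem: "?f i \<in> insert v (set xs)" "?f j \<in> insert v (set xs)" using ij nth_mem[of _ "v # xs"] by auto
    have "adj E (?f i) (?f j) \<longleftrightarrow> j = Suc i mod ?k \<or> i = Suc j mod ?k"
    proof (cases i j rule: linorder_cases)
      case less
      then show ?thesis using ordered ij by blast
    next
      case equal
      then show ?thesis using loopless ij xs(2) by (auto simp: mod_Suc split: if_splits)
    next
      case greater
      then show ?thesis using ordered[of j i] ij adj_commute[of E "?f i"] by blast
    qed
    then show ?thesis
      unfolding cycle_edges_iff[OF ij] using mem by (simp add: induced_edges_def adj_def)
  qed
  moreover have "bij_betw ?f {..<?k} (insert v (set xs))"
    using bij_betw_nth[OF xs(4)] by simp
  ultimately have "graph_iso {..<?k} (cycle_edges ?k) (insert v (set xs)) (induced_edges E (insert v (set xs)))"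
    by (auto simp: graph_iso_def)
  moreover have "induced_free {..<?k} (cycle_edges ?k) V E"
    using assms(1) xs(2) by (simp add: chordal_def)
  ultimately show False using assms(3) unfolding induced_free_def by blast
qed

lemma mod_add_eq_iff:
  fixes s i j k :: nat
  assumes "i < k" "j < k"
  shows "(s + i) mod k = (s + j) mod k \<longleftrightarrow> i = j"
proof -
  have "\<not> i < j" if "(s + i) mod k = (s + j) mod k" "i < k" "j < k" for i j
  proof
    assume "i < j"
    then have "k dvd (s + j) - (s + i)" using that(1) mod_eq_dvd_iff_nat[of "s + i" "s + j" k] by simp
    then show False using \<open>i < j\<close> that(3) by (auto dest: dvd_imp_le)
  qed
  then show ?thesis using assms by (metis linorder_neqE_nat)
qed

text \<open>Rotating the numbering of an induced cycle puts any prescribed vertex \<open>v\<close>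
  at position 0; positions 1 to \<open>k - 1\<close> then list the induced path that
  remains.\<close>

lemma not_chordal_hole:
  assumes "\<not> chordal V E"
  obtains H where "H \<subseteq> V" "H \<noteq> {}" "\<And>v. v \<in> H \<Longrightarrow> \<exists>xs. hole E v xs \<and> set xs = H - {v}"
proof -
  obtain k H f where k: "4 \<le> k" and H: "H \<subseteq> V" and f: "bij_betw f {..<k} H"
    and iso: "\<And>i j. i < k \<Longrightarrow> j < k \<Longrightarrow> {i, j} \<in> cycle_edges k \<longleftrightarrow> {f i, f j} \<in> induced_edges E H"
    using assms unfolding chordal_def induced_free_def graph_iso_def by auto
  have fH: "f i \<in> H" if "i < k" for i using f that bij_betwE by fastforce
  have inj: "f i = f j \<longleftrightarrow> i = j" if "i < k" "j < k" for i j
    using f that by (auto simp: bij_betw_def inj_on_def)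
  have adj_f: "adj E (f i) (f j) \<longleftrightarrow> j = Suc i mod k \<or> i = Suc j mod k" if "i < k" "j < k" for i j
    using iso[OF that] fH that unfolding cycle_edges_iff[OF that] by (simp add: induced_edges_def adj_def)
  have "\<exists>xs. hole E v xs \<and> set xs = H - {v}" if "v \<in> H" for v
  proof -
    have "v \<in> f ` {..<k}" using f that by (simp add: bij_betw_def)
    then obtain s where s: "s < k" "v = f s" by auto
    let ?g = "\<lambda>i. f ((s + i) mod k)"
    have g: "?g i = ?g j \<longleftrightarrow> i = j" if "i < k" "j < k" for i j
      using k inj mod_add_eq_iff[OF that] by simp
    have adj_g: "adj E (?g i) (?g j) \<longleftrightarrow> j = Suc i mod k \<or> i = Suc j mod k" if "i < k" "j < k" for i j
    proof -
      have "Suc ((s + i) mod k) mod k = (s + Suc i mod k) mod k" for i by (simp add: mod_simps)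
      then show ?thesis
        using adj_f[of "(s + i) mod k" "(s + j) mod k"] mod_add_eq_iff[of _ k _ s] that k by simp
    qed
    let ?xs = "map ?g [1..<k]"
    have "?g 0 = v" using s by simp
    have nth: "?xs ! i = ?g (Suc i)" if "i < k - 1" for i using that by simp
    have "ipath E ?xs"
    proof (rule ipathI)
      fix i j assume "i < j" "j < length ?xs"
      then show "?xs ! i \<noteq> ?xs ! j \<and> (adj E (?xs ! i) (?xs ! j) \<longleftrightarrow> j = Suc i)"
        using adj_g[of "Suc i" "Suc j"] g[of "Suc i" "Suc j"] by (auto simp: mod_Suc)
    qed
    moreover have "adj E v y \<longleftrightarrow> y = hd ?xs \<or> y = last ?xs" if y: "y \<in> set ?xs" for y
    proof -
      obtain j where j: "1 \<le> j" "j < k" "y = ?g j" using y by auto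
      have "hd ?xs = ?g 1" "last ?xs = ?g (k - 1)" using k by (simp_all add: hd_map last_map)
      then show ?thesis
        using adj_g[of 0 j] g[of j 1] g[of j "k - 1"] j k \<open>?g 0 = v\<close> by (auto simp: mod_Suc)
    qed
    moreover have "set ?xs = H - {v}"
    proof -
      have "?g ` {0..<k} \<subseteq> H" using fH k by auto
      moreover have "inj_on ?g {0..<k}" using g by (auto simp: inj_on_def)
      moreover have "card H = k" "finite H" using f bij_betw_same_card[OF f] bij_betw_finite[OF f] by auto
      ultimately have "H = ?g ` {0..<k}"
        using card_subset_eq[of H "?g ` {0..<k}"] card_image[of ?g "{0..<k}"] by simp
      also have "{0..<k} = insert 0 {1..<k}" using k by auto
      finally have "H = insert v (?g ` {1..<k})" using \<open>?g 0 = v\<close> by (simp only: image_insert)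
      moreover have "?g 0 \<notin> ?g ` {1..<k}"
      proof
        assume "?g 0 \<in> ?g ` {1..<k}"
        then obtain x where "?g 0 = ?g x" "1 \<le> x" "x < k" by auto
        then show False using g[of 0 x] by simp
      qed
      moreover have "set ?xs = ?g ` {1..<k}" by simp
      ultimately show ?thesis using \<open>?g 0 = v\<close> by (metis Diff_insert_absorb)
    qed
    ultimately show ?thesis using k unfolding hole_def by (intro exI[of _ ?xs]) auto
  qed
  moreover have "H \<noteq> {}" using fH k by fastforce
  ultimately show ?thesis using that H by blast
qed

section \<open>Potential maximal cliques\<close>

lemma connected_in_mono: "connected_in E D \<Longrightarrow> E \<subseteq> E' \<Longrightarrow> connected_in E' D"
  unfolding connected_in_def adj_def by (meson subsetD)

text \<open>Choose \<open>d\<close> so that the part of \<open>K\<close> it misses is minimal. If it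
  misses \<open>k\<close>, follow an induced path in \<open>D\<close> from \<open>d\<close> to a
  neighbour of \<open>k\<close>. Its end sees \<open>k\<close> and, by chordality, every neighbour
  of \<open>d\<close> in \<open>K\<close>, which contradicts the choice.\<close>

lemma chordal_clique_complete:
  assumes H: "finite_simple_graph V E" "chordal V E" and KV: "K \<subseteq> V" "clique K E" and DV: "D \<subseteq> V" "D \<inter> K = {}"
    and conn: "connected_in E D" and touch: "\<And>k. k \<in> K \<Longrightarrow> nbs E D k \<noteq> {}"
  shows "\<exists>d\<in>D. \<forall>k\<in>K. adj E d k"
proof -
  have loopless: "\<not> adj E x x" for x using edge_in_V(3)[OF H(1), of x x] by blast
  have K: "adj E x y" if "x \<in> K" "y \<in> K" "x \<noteq> y" for x y
    using KV(2) that by (simp add: clique_def adj_def)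
  have "finite D" "D \<noteq> {}"
    using H(1) DV(1) conn finite_subset by (auto simp: finite_simple_graph_def connected_in_def)
  from ex_minimal_set[OF this, of "\<lambda>d. K - nbs E K d"]
  obtain d where d: "d \<in> D" and max: "\<And>e. e \<in> D \<Longrightarrow> K - nbs E K e \<subseteq> K - nbs E K d \<Longrightarrow> K - nbs E K d \<subseteq> K - nbs E K e"
    by blast
  have "adj E d k" if k: "k \<in> K" for k
  proof (rule ccontr)
    assume "\<not> adj E d k"
    have "{d} \<inter> D \<noteq> {}" "nbs E D k \<inter> D \<noteq> {}" using d touch[OF k] by (auto simp: nbs_def)
    then obtain xs where xs: "xs \<noteq> []" "set xs \<subseteq> D" "ipath E xs" "hd xs \<in> {d}" "last xs \<in> nbs E D k"
      and only: "\<And>y. y \<in> set xs \<Longrightarrow> y \<in> nbs E D k \<Longrightarrow> y = last xs"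
      using connecting_path[OF conn _ _ loopless, of "{d}" "nbs E D k"] by metis
    have xs_k: "adj E y k \<longleftrightarrow> y = last xs" if "y \<in> set xs" for y
      using only[OF that] that xs(2,5) adj_commute[of E y k] by (auto simp: nbs_def)
    have "adj E k' (last xs)" if k': "k' \<in> K" "adj E d k'" for k'
    proof (rule ccontr)
      assume not_last: "\<not> adj E k' (last xs)"
      have "\<exists>x\<in>set xs. adj E k' x" using xs(1,4) k'(2) adj_commute[of E d k'] by (intro bexI[of _ "hd xs"]) auto
      \<comment> \<open>\<open>x\<close> is the last neighbour of \<open>k'\<close> on the path. The
        rest of the path runs from \<open>x\<close> to a neighbour of \<open>k\<close>, and as
        \<open>k\<close> and \<open>k'\<close> are adjacent, \<open>k'\<close> closes it to a
        hole.\<close>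
      then obtain ps x zs where split: "xs = ps @ x # zs" "adj E k' x" "\<forall>z\<in>set zs. \<not> adj E k' z"
        using split_list_last_prop[of xs "adj E k'"] by blast
      have "zs \<noteq> []" using not_last split by auto
      then have last: "last (x # zs) = last xs" using split(1) by simp
      have "ipath E (x # zs)" using xs(3) split(1) ipath_append[of ps "x # zs" E] by (cases "ps = []") auto
      have "k \<notin> set xs" "k' \<notin> set xs" "k \<noteq> k'" using k k' xs(2) DV(2) \<open>\<not> adj E d k\<close> by auto
      have "ipath E ((x # zs) @ [k])"
        using \<open>ipath E (x # zs)\<close> \<open>k \<notin> set xs\<close> split(1) xs_k last by (subst ipath_append) auto
      moreover have "k' \<notin> set ((x # zs) @ [k])" using \<open>k' \<notin> set xs\<close> \<open>k \<noteq> k'\<close> split(1) by auto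
      moreover have "adj E k' y \<longleftrightarrow> y = hd ((x # zs) @ [k]) \<or> y = last ((x # zs) @ [k])"
        if "y \<in> set ((x # zs) @ [k])" for y
        using that split K[OF k'(1) k] \<open>k \<noteq> k'\<close> by auto
      moreover have "3 \<le> length ((x # zs) @ [k])" using \<open>zs \<noteq> []\<close> by (cases zs) auto
      ultimately have "hole E k' ((x # zs) @ [k])" by (simp add: hole_def)
      moreover have "insert k' (set ((x # zs) @ [k])) \<subseteq> V" using k k' KV(1) DV(1) xs(2) split(1) by auto
      ultimately show False using chordal_no_hole[OF H(2) _ _ loopless] by blast
    qed
    then have "nbs E K d \<subseteq> nbs E K (last xs)"
      using adj_commute[of E _ "last xs"] by (auto simp: nbs_def)
    moreover have "last xs \<in> D" using xs(1,2) by auto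
    ultimately have "K - nbs E K d \<subseteq> K - nbs E K (last xs)" using max[of "last xs"] by blast
    moreover have "k \<in> nbs E K (last xs)" using xs_k[of "last xs"] xs(1) k by (simp add: nbs_def)
    ultimately show False using k \<open>\<not> adj E d k\<close> by (auto simp: nbs_def)
  qed
  then show ?thesis using d by blast
qed

text \<open>The first and the last vertex of \<open>xs\<close> outside \<open>D\<close> lie in
  \<open>S\<close>, because each has a neighbour on the hole that is in \<open>D\<close>. As
  \<open>z\<close> lies strictly between them, they are not consecutive on the induced path, hence
  not adjacent, although they are in \<open>S\<close>.\<close>

lemma hole_clique_separator:
  assumes hole: "hole E v xs" and v: "v \<in> D" and out: "z \<in> set xs" "z \<notin> D" "z \<notin> S"
    and sep: "\<And>x y. x \<in> D \<Longrightarrow> adj E x y \<Longrightarrow> y \<in> D \<union> S"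
    and S: "\<And>x y. x \<in> S \<Longrightarrow> y \<in> S \<Longrightarrow> x \<noteq> y \<Longrightarrow> adj E x y"
  shows False
proof -
  have xs: "ipath E xs" "3 \<le> length xs" using hole by (auto simp: hole_def)
  then have "xs \<noteq> []" by auto
  then have hd_last: "adj E v (hd xs)" "adj E v (last xs)" using hole by (auto simp: hole_def)
  obtain as s bs where as: "xs = as @ s # bs" "s \<notin> D" "\<forall>x\<in>set as. x \<in> D"
    using split_list_first_prop[of xs "\<lambda>x. x \<notin> D"] out(1,2) by blast
  obtain cs t ds where cs: "xs = cs @ t # ds" "t \<notin> D" "\<forall>x\<in>set ds. x \<in> D"
    using split_list_last_prop[of xs "\<lambda>x. x \<notin> D"] out(1,2) by blast
  have "s \<in> S"
  proof (cases "as = []")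
    case True
    then show ?thesis using sep[OF v hd_last(1)] as by simp
  next
    case False
    then have "adj E (last as) s" using xs(1) as(1) ipath_append[of as "s # bs" E] by auto
    then show ?thesis using sep[of "last as" s] False as by simp
  qed
  have "t \<in> S"
  proof (cases "ds = []")
    case True
    then show ?thesis using sep[OF v hd_last(2)] cs by simp
  next
    case False
    then have "adj E t (hd ds)" using xs(1) cs(1) ipath_append[of "cs @ [t]" ds E] by auto
    then show ?thesis using sep[of "hd ds" t] False cs adj_commute[of E t "hd ds"] by simp
  qed
  let ?i = "length as" and ?j = "length cs"
  obtain l where l: "l < length xs" "z = xs ! l" using out(1) by (auto simp: in_set_conv_nth)
  have "\<not> l < ?i" using as(1,3) l(2) out(2) by (metis nth_append nth_mem)
  moreover have "xs ! ?i = s" "?i < length xs" using as(1) by simp_all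
  moreover have "xs ! ?j = t" "?j < length xs" using cs(1) by simp_all
  moreover have "\<not> ?j < l"
  proof
    assume "?j < l"
    then have "z = ds ! (l - Suc ?j)" "l - Suc ?j < length ds"
      using l cs(1) by (auto simp: nth_append nth_Cons' )
    then show False using cs(3) out(2) by auto
  qed
  moreover have "l \<noteq> ?i" "l \<noteq> ?j" using calculation l(2) out(3) \<open>s \<in> S\<close> \<open>t \<in> S\<close> by auto
  ultimately have ij: "Suc ?i < ?j" "?j < length xs" "xs ! ?i = s" "xs ! ?j = t" by linarith+
  then have "\<not> adj E s t" "s \<noteq> t"
    using ipath_nth_less[OF xs(1), of ?i ?j] ipath_distinct[OF xs(1)]
    by (auto simp: nth_eq_iff_index_eq)
  then show False using S \<open>s \<in> S\<close> \<open>t \<in> S\<close> by blast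
qed

lemma hole_cong:
  assumes "\<And>x y. x \<in> insert v (set xs) \<Longrightarrow> y \<in> insert v (set xs) \<Longrightarrow> adj E x y \<longleftrightarrow> adj E' x y"
  shows "hole E v xs \<longleftrightarrow> hole E' v xs"
proof -
  have "ipath E ys \<longleftrightarrow> ipath E' ys" if "set ys \<subseteq> set xs" for ys
    using that
  proof (induction ys)
    case (Cons y ys)
    then have "adj E y z \<longleftrightarrow> adj E' y z" if "z \<in> set ys" for z using that assms by auto
    then show ?case using Cons by simp
  qed simp
  then show ?thesis using assms unfolding hole_def by auto
qed

text \<open>For a component \<open>D\<close> of \<open>G - \<Omega>\<close> this is
  \<open>N_G(D)\<close>, since all neighbours of \<open>D\<close> outside \<open>D\<close> lie in
  \<Omega>.\<close>

definition boundary :: "'a set set \<Rightarrow> 'a set \<Rightarrow> 'a set \<Rightarrow> 'a set" where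
  "boundary E \<Omega> D = {w \<in> \<Omega>. nbs E D w \<noteq> {}}"

section \<open>Components of \<open>G - \<Omega>\<close> for a potential maximal clique\<close>

definition components :: "'a set set \<Rightarrow> 'a set \<Rightarrow> 'a set set" where
  "components E U = component E U ` U"

lemma componentsD:
  assumes "D \<in> components E U"
  shows "D \<subseteq> U" "connected_in E D" "\<And>x y. x \<in> D \<Longrightarrow> y \<in> U \<Longrightarrow> adj E x y \<Longrightarrow> y \<in> D"
proof -
  obtain x where x: "x \<in> U" and D: "D = component E U x" using assms by (auto simp: components_def)
  show "D \<subseteq> U" "connected_in E D"
    unfolding D using component_subset[OF x] component_connected[OF x] by simp_all
  show "z \<in> D" if "y \<in> D" "z \<in> U" "adj E y z" for y z
    using component_closed[of y E U x z] that x unfolding D by simp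
qed

lemma components_disjoint:
  assumes "D \<in> components E U" "D' \<in> components E U" "x \<in> D" "x \<in> D'"
  shows "D = D'"
proof -
  have "D \<subseteq> D'" if D: "D \<in> components E U" "D' \<in> components E U" "x \<in> D" "x \<in> D'" for D D'
  proof -
    obtain y where y: "y \<in> U" "D' = component E U y" using D(2) by (auto simp: components_def)
    show ?thesis
      using connected_subset_component[OF componentsD(2,1)[OF D(1)] y(1)] y(2) D(3,4) by blast
  qed
  then show ?thesis using assms by blast
qed

lemma ex_component: "x \<in> U \<Longrightarrow> \<exists>D\<in>components E U. x \<in> D"
  using component_self[of x E U] by (auto simp: components_def)

text \<open>A component attached to all of \<Omega> would contain a vertex that is complete to
  \<Omega> in the chordal completion, against maximality of the clique.\<close>

lemma pmc_not_full:
  assumes G: "finite_simple_graph V E" and pmc: "potential_maximal_clique V E \<Omega>"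
    and D: "D \<in> components E (V - \<Omega>)"
  shows "\<exists>w\<in>\<Omega>. nbs E D w = {}"
proof (rule ccontr)
  assume "\<not> ?thesis"
  then have full: "\<And>w. w \<in> \<Omega> \<Longrightarrow> nbs E D w \<noteq> {}" by blast
  obtain F where F: "minimal_chordal_completion V E F" and \<Omega>: "maximal_clique V (E \<union> F) \<Omega>"
    using pmc by (auto simp: potential_maximal_clique_def)
  have H: "finite_simple_graph V (E \<union> F)" "chordal V (E \<union> F)"
    using F G by (auto simp: minimal_chordal_completion_def chordal_completion_def finite_simple_graph_def)
  have cl: "\<Omega> \<subseteq> V" "clique \<Omega> (E \<union> F)" using \<Omega> by (auto simp: maximal_clique_def)
  have "nbs (E \<union> F) D w \<noteq> {}" if "w \<in> \<Omega>" for w using full[OF that] by (auto simp: nbs_def adj_def)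
  then obtain d where d: "d \<in> D" "\<forall>k\<in>\<Omega>. adj (E \<union> F) d k"
    using chordal_clique_complete[OF H cl, of D] componentsD(1)[OF D]
      connected_in_mono[OF componentsD(2)[OF D], of "E \<union> F"] by blast
  have "clique (insert d \<Omega>) (E \<union> F)"
    using d(2) cl(2) by (auto simp: clique_def adj_def insert_commute)
  moreover have "\<Omega> \<subset> insert d \<Omega>" "insert d \<Omega> \<subseteq> V" using d(1) componentsD(1)[OF D] cl(1) by auto
  ultimately show False using \<Omega> by (auto simp: maximal_clique_def)
qed

text \<open>
  If no component sees both \<open>u\<close> and \<open>v\<close>, then the edge \<open>{u, v}\<close> and all edges of \<open>F\<close> between
  different components, or from a component to a vertex of \<open>\<Omega>\<close> it does not see, are superfluous.
\<close>

lemma pmc_common_component: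
  assumes G: "finite_simple_graph V E" and pmc: "potential_maximal_clique V E \<Omega>"
    and uv: "u \<in> \<Omega>" "v \<in> \<Omega>" "u \<noteq> v" "\<not> adj E u v"
  shows "\<exists>D\<in>components E (V - \<Omega>). u \<in> boundary E \<Omega> D \<and> v \<in> boundary E \<Omega> D"
proof (rule ccontr)
  assume none: "\<not> ?thesis"
  let ?\<D> = "components E (V - \<Omega>)"
  obtain F where F: "F \<subseteq> nsets V 2 - E" "chordal V (E \<union> F)"
    and min: "\<And>F'. F' \<subset> F \<Longrightarrow> F' \<subseteq> nsets V 2 - E \<Longrightarrow> \<not> chordal V (E \<union> F')"
    and \<Omega>: "\<Omega> \<subseteq> V" "clique \<Omega> (E \<union> F)"
    using pmc by (auto simp: potential_maximal_clique_def minimal_chordal_completion_def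
      chordal_completion_def maximal_clique_def)
  define F' where "F' = {e \<in> F. e \<noteq> {u, v} \<and> (e \<subseteq> \<Omega> \<or> (\<exists>D\<in>?\<D>. e \<subseteq> D \<union> boundary E \<Omega> D))}"
  let ?H = "E \<union> F" and ?H' = "E \<union> F'"
  have "{u, v} \<in> F" using \<Omega>(2) uv by (auto simp: clique_def adj_def)
  then have "F' \<subset> F" by (auto simp: F'_def)
  then have "\<not> chordal V ?H'" using min F(1) by blast
  then obtain C where C: "C \<subseteq> V" "C \<noteq> {}" "\<And>x. x \<in> C \<Longrightarrow> \<exists>xs. hole ?H' x xs \<and> set xs = C - {x}"
    using not_chordal_hole by blast
  have loopless: "\<not> adj ?H x x" for x
    using G F(1) edge_in_V(3)[of V ?H x x] by (auto simp: finite_simple_graph_def)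
  have in_\<Omega>: "adj ?H' x y" if "x \<in> \<Omega>" "y \<in> \<Omega>" "x \<noteq> y" "{x, y} \<noteq> {u, v}" for x y
    using that \<Omega>(2) by (auto simp: clique_def adj_def F'_def)
  show False
  proof (cases "C \<subseteq> \<Omega>")
    case True
    obtain x xs where x: "x \<in> C" "hole ?H' x xs" "set xs = C - {x}" using C(2,3) by blast
    \<comment> \<open>Within \<Omega> only the pair \<open>u\<close>, \<open>v\<close> can be
      non-adjacent, whereas a hole \<open>x, a, b, c, ...\<close> has the two non-adjacent pairs
      \<open>{x, b}\<close> and \<open>{a, c}\<close>.\<close>
    then obtain a b c ys where xs: "xs = a # b # c # ys"
      unfolding hole_def by (metis Suc_le_length_iff numeral_3_eq_3)
    have "distinct (x # xs)" using x(2) ipath_distinct by (auto simp: hole_def)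
    then have "\<not> adj ?H' x b" "\<not> adj ?H' a c" "x \<noteq> b" "a \<noteq> c" "{x, b} \<noteq> {a, c}"
      using x(2) unfolding hole_def xs by (auto simp: doubleton_eq_iff split: if_splits)
    moreover have "x \<in> \<Omega>" "a \<in> \<Omega>" "b \<in> \<Omega>" "c \<in> \<Omega>" using True x xs by auto
    ultimately show False using in_\<Omega>[of x b] in_\<Omega>[of a c] by metis
  next
    case False
    then obtain d where d: "d \<in> C" "d \<notin> \<Omega>" by blast
    then obtain D where D: "D \<in> ?\<D>" "d \<in> D" using ex_component[of d "V - \<Omega>" E] C(1) by blast
    obtain xs where xs: "hole ?H' d xs" "set xs = C - {d}" using C(3) d by blast
    let ?S = "boundary E \<Omega> D"
    have D\<Omega>: "D \<subseteq> V - \<Omega>" using componentsD(1)[OF D(1)] .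
    show False
    proof (cases "C \<subseteq> D \<union> ?S")
      case True
      \<comment> \<open>Not both \<open>u\<close> and \<open>v\<close> are in the boundary of
        \<open>D\<close>, so no edge of \<open>F\<close> inside \<open>D\<close> and its boundary
        was discarded, and the hole would be one of the chordal graph \<open>?H\<close>.\<close>
      have "adj ?H' x y \<longleftrightarrow> adj ?H x y" if "x \<in> D \<union> ?S" "y \<in> D \<union> ?S" for x y
      proof -
        have "{x, y} \<noteq> {u, v} \<or> {x, y} \<in> E"
        proof (rule ccontr)
          assume "\<not> ({x, y} \<noteq> {u, v} \<or> {x, y} \<in> E)"
          then have "u \<in> ?S" "v \<in> ?S" using that D\<Omega> uv by (auto simp: doubleton_eq_iff)
          then show False using none D(1) by blast
        qed
        moreover have "{x, y} \<subseteq> D \<union> ?S" using that by simp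
        ultimately have "{x, y} \<in> ?H \<Longrightarrow> {x, y} \<in> ?H'" using D(1) unfolding F'_def by blast
        moreover have "{x, y} \<in> ?H' \<Longrightarrow> {x, y} \<in> ?H" using \<open>F' \<subset> F\<close> by blast
        ultimately show ?thesis unfolding adj_def by blast
      qed
      moreover have "insert d (set xs) \<subseteq> D \<union> ?S" using True xs(2) d(1) by blast
      ultimately have "hole ?H d xs"
        using xs(1) hole_cong[of d xs ?H' ?H] by blast
      then show False using chordal_no_hole[OF F(2) _ _ loopless] xs(2) C(1) d(1) by blast
    next
      case False
      \<comment> \<open>The hole leaves \<open>D\<close> and its boundary. In \<open>?H'\<close>
        this boundary is a clique that contains all neighbours of \<open>D\<close> outside
        \<open>D\<close>, so no hole can cross it.\<close>
      then obtain z where "z \<in> set xs" "z \<notin> D" "z \<notin> ?S" using xs(2) D(2) by blast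
      then show False
      proof (rule hole_clique_separator[OF xs(1) D(2)])
        fix x y assume x: "x \<in> D" and xy: "adj ?H' x y"
        show "y \<in> D \<union> ?S"
        proof (cases "adj E x y")
          case True
          then have "y \<in> V" using edge_in_V(2)[OF G] by blast
          then show ?thesis
            using componentsD(3)[OF D(1) x _ True] True x adj_commute[of E x y]
            by (auto simp: boundary_def nbs_def)
        next
          case False
          then have "{x, y} \<in> F'" using xy by (auto simp: adj_def)
          then obtain D' where D': "D' \<in> ?\<D>" "x \<in> D' \<union> boundary E \<Omega> D'" "y \<in> D' \<union> boundary E \<Omega> D'"
            using x D\<Omega> by (auto simp: F'_def)
          then have "D' = D"
            using components_disjoint[OF D'(1) D(1) _ x] x D\<Omega> by (auto simp: boundary_def)
          then show ?thesis using D' by simp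
        qed
      next
        fix x y assume "x \<in> ?S" "y \<in> ?S" "x \<noteq> y"
        moreover have "{x, y} \<noteq> {u, v}" using none D(1) calculation by (auto simp: doubleton_eq_iff)
        ultimately show "adj ?H' x y" using in_\<Omega>[of x y] by (simp add: boundary_def)
      qed
    qed
  qed
qed

text \<open>The second side is the component of \<open>G - N[D]\<close> containing a vertex
  \<open>w\<close> of \<Omega> that \<open>D\<close> does not see. A vertex \<open>s\<close> of the
  boundary is adjacent to \<open>w\<close> or shares with it a component \<open>D'\<close> other
  than \<open>D\<close>, and \<open>D'\<close> lies inside this side.\<close>

lemma boundary_covered:
  assumes G: "finite_simple_graph V E" and P7: "P_free 7 V E" and pmc: "potential_maximal_clique V E \<Omega>"
    and \<Omega>V: "\<Omega> \<subseteq> V" and D: "D \<in> components E (V - \<Omega>)"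
  shows "covered V E (boundary E \<Omega> D) 22"
proof -
  let ?S = "boundary E \<Omega> D"
  obtain w where w: "w \<in> \<Omega>" "nbs E D w = {}" using pmc_not_full[OF G pmc D] by blast
  let ?U = "V - D - ?S"
  have DV: "D \<subseteq> V - \<Omega>" using componentsD(1)[OF D] .
  have wU: "w \<in> ?U" using w DV \<Omega>V by (auto simp: boundary_def)
  let ?B = "component E ?U w"
  have BU: "?B \<subseteq> ?U" using component_subset[OF wU] .
  interpret two_sides V E D ?B
  proof
    fix a b assume a: "a \<in> D" and b: "b \<in> ?B"
    show "\<not> adj E a b"
    proof
      assume ab: "adj E a b"
      have "b \<in> V" "b \<notin> D" "b \<notin> ?S" using b BU by auto
      moreover have "b \<notin> \<Omega>"
        using \<open>b \<notin> ?S\<close> ab a adj_commute[of E a b] by (auto simp: boundary_def nbs_def)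
      ultimately show False using componentsD(3)[OF D a _ ab] by blast
    qed
  qed (use G P7 DV BU in auto)
  have B: "nbs E ?B s \<noteq> {}" if s: "s \<in> ?S" for s
  proof (cases "adj E s w")
    case True
    then show ?thesis using component_self[of w E ?U] by (auto simp: nbs_def)
  next
    case False
    have "s \<in> \<Omega>" "s \<noteq> w" using s w(2) by (auto simp: boundary_def)
    then obtain D' where D': "D' \<in> components E (V - \<Omega>)" "s \<in> boundary E \<Omega> D'" "w \<in> boundary E \<Omega> D'"
      using pmc_common_component[OF G pmc _ w(1) _ False] by blast
    have "D' \<noteq> D" using D'(3) w(2) by (auto simp: boundary_def)
    then have "D' \<inter> D = {}" using components_disjoint[OF D'(1) D] by blast
    then have D'U: "D' \<subseteq> ?U" using componentsD(1)[OF D'(1)] by (auto simp: boundary_def)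
    obtain r where r: "r \<in> D'" "adj E w r" using D'(3) by (auto simp: boundary_def nbs_def)
    then have "r \<in> ?B" using component_closed[OF component_self wU _ r(2)] D'U by blast
    then have "D' \<subseteq> ?B"
      using connected_subset_component[OF componentsD(2)[OF D'(1)] D'U wU] r(1) by blast
    then show ?thesis using D'(2) by (auto simp: boundary_def nbs_def)
  qed
  show ?thesis
  proof (rule covered_between[OF componentsD(2)[OF D] component_connected[OF wU]])
    show "?S \<subseteq> V" using \<Omega>V by (auto simp: boundary_def)
  qed (use B in \<open>auto simp: boundary_def\<close>)
qed

text \<open>The hypotheses yield an induced path \<open>t1, a, zs, b, xs, c, t4\<close> with
  \<open>zs\<close> in \<open>T2\<close> and \<open>xs\<close> in \<open>T3\<close>. It is built
  from its end, \<open>path_through\<close> supplying the two inner stretches; as these are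
  nonempty, there are at least seven vertices.\<close>

lemma no_component_path:
  assumes G: "finite_simple_graph V E" and P7: "P_free 7 V E" and \<Omega>V: "\<Omega> \<subseteq> V"
    and T: "T1 \<in> components E (V - \<Omega>)" "T2 \<in> components E (V - \<Omega>)"
      "T3 \<in> components E (V - \<Omega>)" "T4 \<in> components E (V - \<Omega>)"
    and in\<Omega>: "a \<in> \<Omega>" "b \<in> \<Omega>" "c \<in> \<Omega>"
    and indep: "a \<noteq> b" "a \<noteq> c" "b \<noteq> c" "\<not> adj E a b" "\<not> adj E a c" "\<not> adj E b c"
    and a: "nbs E T1 a \<noteq> {}" "nbs E T2 a \<noteq> {}" "nbs E T3 a = {}" "nbs E T4 a = {}"
    and b: "nbs E T1 b = {}" "nbs E T2 b \<noteq> {}" "nbs E T3 b \<noteq> {}" "nbs E T4 b = {}"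
    and c: "nbs E T1 c = {}" "nbs E T2 c = {}" "nbs E T3 c \<noteq> {}" "nbs E T4 c \<noteq> {}"
  shows False
proof -
  let ?\<D> = "components E (V - \<Omega>)"
  have loopless: "\<not> adj E x x" for x using edge_in_V(3)[OF G, of x x] by blast
  have sub: "x \<in> V" "x \<notin> \<Omega>" if "x \<in> D" "D \<in> ?\<D>" for x D
    using componentsD(1)[OF that(2)] that(1) by auto
  have apart: "x \<noteq> y \<and> \<not> adj E x y" if "x \<in> D" "y \<in> D'" "D \<in> ?\<D>" "D' \<in> ?\<D>" "D \<noteq> D'" for x y D D'
  proof -
    have "y \<notin> D" using components_disjoint[OF that(3,4) _ that(2)] that(5) by blast
    then show ?thesis using componentsD(3)[OF that(3,1), of y] sub[OF that(2,4)] that(1) by blast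
  qed
  have far: "\<not> adj E x z" "\<not> adj E z x" if "nbs E D z = {}" "x \<in> D" for x z D
    using that adj_commute[of E x z] by (auto simp: nbs_def)
  have ne: "T1 \<noteq> T2" "T1 \<noteq> T3" "T1 \<noteq> T4" "T2 \<noteq> T3" "T2 \<noteq> T4" "T3 \<noteq> T4" using a b c by auto
  obtain t1 t4 where t1: "t1 \<in> T1" "adj E t1 a" and t4: "t4 \<in> T4" "adj E c t4"
    using a(1) c(4) adj_commute[of E a] by (auto simp: nbs_def)
  have t4': "t4 \<notin> \<Omega>" "\<not> adj E b t4" "\<not> adj E a t4" using sub t4(1) T(4) far a(4) b(4) by auto
  have t1': "t1 \<notin> \<Omega>" "\<not> adj E t1 b" "\<not> adj E t1 c" using sub t1(1) T(1) far b(1) c(1) by auto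
  have "ipath E [c, t4]" using t4 t4'(1) in\<Omega>(3) by auto
  then obtain xs where xs: "xs \<noteq> []" "set xs \<subseteq> T3" "ipath E (b # xs @ [c, t4])"
  proof (rule path_through)
    show "connected_in E T3" using componentsD(2)[OF T(3)] .
    show "T3 \<inter> set [c, t4] = {}" using sub(2)[OF _ T(3)] in\<Omega>(3) apart[OF _ t4(1) T(3,4) ne(6)] by auto
    show "\<not> adj E d z" if "d \<in> T3" "z \<in> set (tl [c, t4])" for d z
      using that apart[OF _ t4(1) T(3,4) ne(6)] by auto
    show "b \<notin> T3" using sub(2)[OF _ T(3)] in\<Omega> by blast
  qed (use b c indep in\<Omega> t4' loopless in auto)
  let ?ys = "b # xs @ [c, t4]"
  from xs(3) obtain zs where zs: "zs \<noteq> []" "set zs \<subseteq> T2" "ipath E (a # zs @ ?ys)"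
  proof (rule path_through)
    show "connected_in E T2" using componentsD(2)[OF T(2)] .
    have "T2 \<inter> set xs = {}" using apart[OF _ _ T(2,3) ne(4)] xs(2) by blast
    then show "T2 \<inter> set ?ys = {}"
      using sub(2)[OF _ T(2)] in\<Omega> apart[OF _ t4(1) T(2,4) ne(5)] by auto
    show "\<not> adj E d z" if "d \<in> T2" "z \<in> set (tl ?ys)" for d z
      using that far(1)[OF c(2)] apart[OF _ t4(1) T(2,4) ne(5)] apart[OF _ _ T(2,3) ne(4)] xs(2) by auto
    show "a \<notin> T2" using sub(2)[OF _ T(2)] in\<Omega> by blast
    show "a \<notin> set ?ys" using indep t4'(1) in\<Omega>(1) xs(2) sub(2)[OF _ T(3)] by auto
    show "\<not> adj E a z" if "z \<in> set ?ys" for z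
      using that indep t4'(3) far(2)[OF a(3)] xs(2) by auto
  qed (use b a loopless in auto)
  let ?zs = "a # zs @ ?ys"
  have "t1 \<notin> set ?zs \<and> (\<forall>z\<in>set ?zs. adj E t1 z \<longleftrightarrow> z = a)"
  proof -
    have "t1 \<noteq> z \<and> \<not> adj E t1 z" if "z \<in> set zs \<or> z \<in> set xs \<or> z = t4" for z
      using that apart[OF t1(1) _ T(1,2) ne(1)] apart[OF t1(1) _ T(1,3) ne(2)]
        apart[OF t1(1) t4(1) T(1,4) ne(3)] zs(2) xs(2) by auto
    moreover have "a \<notin> set zs" "a \<notin> set xs" "a \<noteq> t4"
      using in\<Omega>(1) sub(2)[OF _ T(2)] sub(2)[OF _ T(3)] zs(2) xs(2) t4'(1) by auto
    ultimately show ?thesis using t1 t1' in\<Omega> indep by auto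
  qed
  then have "ipath E (t1 # ?zs)" using zs(3) by simp
  moreover have "set (t1 # ?zs) \<subseteq> V"
    using t1(1) t4(1) zs(2) xs(2) in\<Omega> \<Omega>V sub(1)[OF _ T(1)] sub(1)[OF _ T(2)] sub(1)[OF _ T(3)] sub(1)[OF _ T(4)]
    by auto
  ultimately have "length (t1 # ?zs) < 7" using P_free_ipath[OF G P7] by blast
  moreover have "length xs \<ge> 1" "length zs \<ge> 1" using xs(1) zs(1) by (simp_all add: Suc_le_eq)
  ultimately show False by simp
qed

section \<open>Choice of two vertices and three components that cover \<Omega>\<close>

theorem theorem1p4:
  fixes V :: "'a set" and E :: "'a set set" and \<Omega> :: "'a set"
  assumes "finite_simple_graph V E"
    and "P_free 7 V E"
    and "potential_maximal_clique V E \<Omega>"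
  shows "\<exists>\<Omega>'\<subseteq>V. card \<Omega>' \<le> 68 \<and> \<Omega> \<subseteq> closed_nbhd V E \<Omega>'"
proof -
  note G = assms(1)
  have \<Omega>V: "\<Omega> \<subseteq> V" using assms(3) by (auto simp: potential_maximal_clique_def maximal_clique_def)
  have "finite V" using G by (simp add: finite_simple_graph_def)
  then have "finite \<Omega>" using \<Omega>V finite_subset by blast
  define F where "F w = {D \<in> components E (V - \<Omega>). nbs E D w \<noteq> {}}" for w
  have common: "F u \<inter> F v \<noteq> {}" if "u \<in> \<Omega>" "v \<in> \<Omega>" "u \<noteq> v" "\<not> adj E u v" for u v
    using pmc_common_component[OF G assms(3) that] by (auto simp: F_def boundary_def)
  have cover: "covered V E {w \<in> \<Omega>. D \<in> F w} 22" if "D \<in> F u" for D u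
    using boundary_covered[OF assms \<Omega>V, of D] that by (rule_tac covered_mono) (auto simp: F_def boundary_def)
  have "covered V E \<Omega> 68"
  proof (cases "\<Omega> = {}")
    case True
    then show ?thesis by (auto simp: covered_def)
  next
    case False
    from ex_minimal_set[OF \<open>finite \<Omega>\<close> this, of F]
    obtain u where u: "u \<in> \<Omega>" and umin: "\<And>w. w \<in> \<Omega> \<Longrightarrow> F w \<subseteq> F u \<Longrightarrow> F u \<subseteq> F w"
      by blast
    \<comment> \<open>Candidates for the second vertex. If there are none, every vertex of \<Omega>
      far from \<open>u\<close> is seen by all of \<open>F u\<close>, so one boundary suffices; if
      \<open>F u\<close> is empty, no vertex is far from \<open>u\<close>, by
      \<open>common\<close>.\<close>
    define I where "I = {w \<in> \<Omega>. w \<noteq> u \<and> \<not> adj E u w \<and> \<not> F u \<subseteq> F w}"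
    show ?thesis
    proof (cases "I = {}")
      case True
      have "covered V E {w \<in> \<Omega>. \<forall>x\<in>set [u]. w \<noteq> x \<and> \<not> adj E x w} 22"
      proof (cases "F u = {}")
        case True
        then have "{w \<in> \<Omega>. \<forall>x\<in>set [u]. w \<noteq> x \<and> \<not> adj E x w} = {}" using common[OF u] by auto
        then show ?thesis by (auto simp: covered_def)
      next
        case False
        then obtain D where "D \<in> F u" by blast
        moreover have "{w \<in> \<Omega>. \<forall>x\<in>set [u]. w \<noteq> x \<and> \<not> adj E x w} \<subseteq> {w \<in> \<Omega>. D \<in> F w}"
          using \<open>I = {}\<close> \<open>D \<in> F u\<close> by (auto simp: I_def)
        ultimately show ?thesis using cover covered_mono by blast
      qed
      then have "covered V E \<Omega> (length [u] + 22)"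
        using u \<Omega>V by (intro covered_diff[OF G]) auto
      then show ?thesis by (rule covered_mono) auto
    next
      case False
      have "finite I" using \<open>finite \<Omega>\<close> by (simp add: I_def)
      from ex_minimal_set[OF this False, of "\<lambda>w. F u \<inter> F w"]
      obtain w where "w \<in> I" and wmin: "\<And>z. z \<in> I \<Longrightarrow> F u \<inter> F z \<subseteq> F u \<inter> F w \<Longrightarrow> F u \<inter> F w \<subseteq> F u \<inter> F z"
        by blast
      then have w: "w \<in> \<Omega>" "w \<noteq> u" "\<not> adj E u w" "\<not> F u \<subseteq> F w" by (auto simp: I_def)
      \<comment> \<open>\<open>D\<close> exists because \<open>w\<close> is in \<open>I\<close>,
        \<open>D'\<close> because otherwise minimality of \<open>F u\<close> would put
        \<open>F u\<close> inside \<open>F w\<close>, and \<open>D''\<close> because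
        \<open>u\<close> and \<open>w\<close> are not adjacent.\<close>
      obtain D D' D'' where D: "D \<in> F u" "D \<notin> F w" and D': "D' \<in> F w" "D' \<notin> F u" and D'': "D'' \<in> F u" "D'' \<in> F w"
        using w umin[OF w(1)] common[OF u w(1)] by blast
      have "{z \<in> \<Omega>. \<forall>x\<in>set [u, w]. z \<noteq> x \<and> \<not> adj E x z} \<subseteq>
        {z \<in> \<Omega>. D \<in> F z} \<union> {z \<in> \<Omega>. D' \<in> F z} \<union> {z \<in> \<Omega>. D'' \<in> F z}"
      proof (rule ccontr)
        assume "\<not> ?thesis"
        then obtain z where z: "z \<in> \<Omega>" "z \<noteq> u" "z \<noteq> w" "\<not> adj E u z" "\<not> adj E w z"
          and not_in: "D \<notin> F z" "D' \<notin> F z" "D'' \<notin> F z"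
          by auto
        have "z \<in> I" using z D(1) not_in(1) by (auto simp: I_def)
        \<comment> \<open>As \<open>D''\<close> is in \<open>F u\<close> and \<open>F w\<close> but
          not in \<open>F z\<close>, minimality of the intersection with \<open>F u\<close> gives
          \<open>T\<close>. As \<open>D\<close> is in \<open>F u\<close> but not in
          \<open>F z\<close>, minimality of \<open>F u\<close> gives \<open>T'\<close>.\<close>
        then obtain T where T: "T \<in> F u" "T \<in> F z" "T \<notin> F w" using wmin[of z] D'' not_in(3) by blast
        obtain T' where T': "T' \<in> F z" "T' \<notin> F u" using umin[OF z(1)] D(1) not_in(1) by blast
        have comp: "X \<in> components E (V - \<Omega>)" if "X \<in> F x" for X x using that by (simp add: F_def)
        have F_iff: "X \<in> F x \<longleftrightarrow> nbs E X x \<noteq> {}" if "X \<in> components E (V - \<Omega>)" for X x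
          using that by (simp add: F_def)
        note mem = D D' D'' T T' not_in
        note mem' = mem[unfolded F_iff[OF comp[OF D(1)]] F_iff[OF comp[OF D'(1)]] F_iff[OF comp[OF D''(1)]]
            F_iff[OF comp[OF T(1)]] F_iff[OF comp[OF T'(1)]]]
        show False
        \<comment> \<open>The path runs through \<open>D, u, T, z, T', w, D'\<close> if
          \<open>T'\<close> is in \<open>F w\<close>, and through
          \<open>D', w, D'', u, T, z, T'\<close> otherwise.\<close>
        proof (cases "T' \<in> F w")
          case True
          then have "nbs E T' w \<noteq> {}" by (simp add: F_def)
          then show False
            using mem' z w adj_commute[of E w z] u
            by (intro no_component_path[OF G assms(2) \<Omega>V comp[OF D(1)] comp[OF T(1)] comp[OF T'(1)] comp[OF D'(1)],
                  of u z w]) auto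
        next
          case False
          then have "nbs E T' w = {}" using comp[OF T'(1)] by (simp add: F_def)
          then show False
            using mem' z w adj_commute[of E w u] u
            by (intro no_component_path[OF G assms(2) \<Omega>V comp[OF D'(1)] comp[OF D''(1)] comp[OF T(1)] comp[OF T'(1)],
                  of w u z]) auto
        qed
      qed
      moreover have "covered V E ({z \<in> \<Omega>. D \<in> F z} \<union> {z \<in> \<Omega>. D' \<in> F z} \<union> {z \<in> \<Omega>. D'' \<in> F z}) (22 + 22 + 22)"
        by (intro covered_Un cover[OF D(1)] cover[OF D'(1)] cover[OF D''(1)])
      ultimately have "covered V E {z \<in> \<Omega>. \<forall>x\<in>set [u, w]. z \<noteq> x \<and> \<not> adj E x z} 66"
        by (auto intro: covered_mono)
      then have "covered V E \<Omega> (length [u, w] + 66)"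
        using u w(1) \<Omega>V by (intro covered_diff[OF G]) auto
      then show ?thesis by simp
    qed
  qed
  then show ?thesis by (auto simp: covered_def)
qed

end
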